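(* Let $K\subset\mathbb R^2$ be the standard Sierpiński gasket, i.e. the unique nonempty compact set with $K=\bigcup_{i=0}^2F_i(K)$, where $F_i(z)=\frac{z+p_i}{2}$, $p_0=(0,0)$, $p_1=(1,0)$, $p_2=\left(\frac12,\frac{\sqrt3}{2}\right)$. Let $X_{\mathrm{SG}}=\bigcup_{n\ge0}2^nK$ be the unbounded Sierpiński gasket, equipped with the Euclidean metric $d(x,y)=|x-y|$ and the $\alpha$-dimensional Hausdorff measure $\mu$, where $\alpha=\frac{\log 3}{\log 2}$. Let $o=p_0$, $V_o(r)=\mu(B_r(o))$, $h_o(t)=e^{-\alpha t}V_o(e^t)$ and $M_o(T)=\frac1T\int_0^Th_o(t)\,dt$. Let $1\le p<\infty$. Then the limit $$\mathsf M_\alpha(X_{\mathrm{SG}})=\lim_{T\to\infty}M_o(T)=\frac1{\log2}\int_0^{\log2}h_o(t)\,dt$$ exists and is finite, and for every $u\in\mathcal D_{\alpha,p}$, $$\lim_{s\downarrow0}\mathcal E_s(u)=\frac{2\alpha}{p}\,\mathsf M_\alpha(X_{\mathrm{SG}})\,\|u\|_p^p.$$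
   Context: Here $X=X_{\mathrm{SG}}$. Balls are closed balls in $X$: $B_r(x)=\{y\in X:d(x,y)\le r\}$. The norm of $L^p(X,\mu)$ is $\|u\|_p=\left(\int_X|u|^p\,d\mu\right)^{1/p}$. For $s>0$, $$[u]_{s,p;\alpha}^p=\iint_{x\ne y}\frac{|u(x)-u(y)|^p}{d(x,y)^{\alpha+sp}}\,d\mu(x)\,d\mu(y),\qquad \mathcal E_s(u)=s\,[u]_{s,p;\alpha}^p,$$ $$\mathcal D_{\alpha,p}=\bigcup_{0<s_0<1}\{u\in L^p(X,\mu):[u]_{s_0,p;\alpha}<\infty\}.$$ *)

theory Defs
  imports "HOL-Analysis.Analysis"
begin

section \<open>Hausdorff measure\<close>

text \<open>
  The sums run over countable covers; finite covers are included, since sets of a cover may be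
  empty and \<^term>\<open>diameter {} = 0\<close>.  The dimension \<open>a\<close> is meant to be positive:
  \<^term>\<open>0 powr a = 0\<close> in HOL, also for \<open>a = 0\<close>.  No normalising constant is used.
\<close>

definition hausdorff_premeasure :: "real \<Rightarrow> real \<Rightarrow> 'a::metric_space set \<Rightarrow> ennreal" where
  "hausdorff_premeasure a \<delta> A =
     (INF C \<in> {C :: nat \<Rightarrow> 'a set. A \<subseteq> (\<Union>i. C i) \<and> (\<forall>i. bounded (C i) \<and> diameter (C i) \<le> \<delta>)}.
        \<Sum>i. ennreal (diameter (C i) powr a))"

definition hausdorff_outer_measure :: "real \<Rightarrow> 'a::metric_space set \<Rightarrow> ennreal" where
  "hausdorff_outer_measure a A = (SUP \<delta> \<in> {0<..}. hausdorff_premeasure a \<delta> A)"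

text \<open>The measurable sets are those measurable in the sense of Caratheodory.\<close>

definition hausdorff_measure :: "real \<Rightarrow> 'a::metric_space measure" where
  "hausdorff_measure a =
     measure_of UNIV (lambda_system UNIV UNIV (hausdorff_outer_measure a)) (hausdorff_outer_measure a)"

text \<open>
  \<^const>\<open>measure_of\<close> returns the null measure when its last argument is not a measure.  The
  following facts show that this does not happen here.
\<close>

lemma hausdorff_premeasure_empty: "\<delta> > 0 \<Longrightarrow> hausdorff_premeasure a \<delta> {} = 0"
  unfolding hausdorff_premeasure_def
  by (rule antisym, rule INF_lower2[where i = "\<lambda>_. {}"]) auto

lemma hausdorff_premeasure_mono:
  "A \<subseteq> B \<Longrightarrow> hausdorff_premeasure a \<delta> A \<le> hausdorff_premeasure a \<delta> B"
  unfolding hausdorff_premeasure_def by (rule INF_superset_mono) auto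

lemma hausdorff_premeasure_countably_subadditive:
  "hausdorff_premeasure a \<delta> (\<Union>i. A i) \<le> (\<Sum>i. hausdorff_premeasure a \<delta> (A i))"
proof (rule ennreal_le_epsilon)
  fix e :: real
  assume fin: "(\<Sum>i. hausdorff_premeasure a \<delta> (A i)) < top" and e: "0 < e"
  let ?P = "\<lambda>n C. A n \<subseteq> (\<Union>i. C i) \<and> (\<forall>i. bounded (C i) \<and> diameter (C i) \<le> \<delta>)"
  let ?S = "\<lambda>C. \<Sum>i. ennreal (diameter (C i :: 'a set) powr a)"
  have "\<exists>C. ?P n C \<and> ?S C \<le> hausdorff_premeasure a \<delta> (A n) + ennreal (e * (1/2)^Suc n)" for n
  proof -
    have "hausdorff_premeasure a \<delta> (A n) < top"
      using fin ennreal_suminf_lessD by blast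
    moreover have "0 < ennreal (e * (1/2)^Suc n)"
      using e by simp
    ultimately have "hausdorff_premeasure a \<delta> (A n)
        < hausdorff_premeasure a \<delta> (A n) + ennreal (e * (1/2)^Suc n)"
      by (cases "hausdorff_premeasure a \<delta> (A n)" rule: ennreal_cases)
        (auto simp flip: ennreal_plus simp: ennreal_less_iff e)
    then show ?thesis
      unfolding hausdorff_premeasure_def[of a \<delta> "A n"] INF_less_iff by (auto intro: less_imp_le)
  qed
  then obtain C where C: "\<And>n. ?P n (C n)"
    and S: "\<And>n. ?S (C n) \<le> hausdorff_premeasure a \<delta> (A n) + ennreal (e * (1/2)^Suc n)"
    by metis
  define D where "D k = (case prod_decode k of (n, i) \<Rightarrow> C n i)" for k
  have "hausdorff_premeasure a \<delta> (\<Union>i. A i) \<le> ?S D"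
  proof -
    have "x \<in> (\<Union>k. D k)" if "x \<in> A n" for x n
    proof -
      obtain i where "x \<in> C n i" using C[of n] \<open>x \<in> A n\<close> by blast
      then have "x \<in> D (prod_encode (n, i))" by (simp add: D_def)
      then show ?thesis by blast
    qed
    moreover have "bounded (D k) \<and> diameter (D k) \<le> \<delta>" for k
      using C by (auto simp: D_def split: prod.split)
    ultimately show ?thesis
      unfolding hausdorff_premeasure_def by (intro INF_lower) blast
  qed
  also have "?S D = (\<Sum>n. ?S (C n))"
  proof -
    let ?f = "\<lambda>(n, i). ennreal (diameter (C n i) powr a)"
    have "(\<Sum>k. ?f (prod_decode k)) = (\<Sum>n. ?S (C n))"
      by (rule suminf_ennreal_2dimen[unfolded comp_def]) simp
    moreover have "ennreal (diameter (D k) powr a) = ?f (prod_decode k)" for k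
      by (simp add: D_def split: prod.split)
    ultimately show ?thesis by presburger
  qed
  also have "\<dots> \<le> (\<Sum>n. hausdorff_premeasure a \<delta> (A n) + ennreal (e * (1/2)^Suc n))"
    by (intro suminf_le S) auto
  also have "\<dots> = (\<Sum>n. hausdorff_premeasure a \<delta> (A n)) + (\<Sum>n. ennreal (e * (1/2)^Suc n))"
    by (rule suminf_add[symmetric]) auto
  also have "(\<Sum>n. ennreal (e * (1/2)^Suc n)) = ennreal e"
    using e sums_mult[OF power_half_series, of e] by (intro suminf_ennreal_eq) auto
  finally show "hausdorff_premeasure a \<delta> (\<Union>i. A i)
      \<le> (\<Sum>i. hausdorff_premeasure a \<delta> (A i)) + ennreal e" .
qed

lemma outer_measure_space_hausdorff: "outer_measure_space UNIV (hausdorff_outer_measure a)"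
  unfolding outer_measure_space_def positive_def increasing_def countably_subadditive_def
proof (intro conjI allI impI ballI)
  show "hausdorff_outer_measure a {} = 0"
    by (simp add: hausdorff_outer_measure_def hausdorff_premeasure_empty)
next
  fix A B :: "'a set" assume "A \<subseteq> B"
  then show "hausdorff_outer_measure a A \<le> hausdorff_outer_measure a B"
    unfolding hausdorff_outer_measure_def by (intro SUP_mono') (rule hausdorff_premeasure_mono)
next
  fix A :: "nat \<Rightarrow> 'a set"
  show "hausdorff_outer_measure a (\<Union>i. A i) \<le> (\<Sum>i. hausdorff_outer_measure a (A i))"
    unfolding hausdorff_outer_measure_def[of a "\<Union>i. A i"]
  proof (rule SUP_least)
    fix \<delta> :: real assume \<delta>: "\<delta> \<in> {0<..}"
    have "(\<Sum>i. hausdorff_premeasure a \<delta> (A i)) \<le> (\<Sum>i. hausdorff_outer_measure a (A i))"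
      unfolding hausdorff_outer_measure_def by (intro suminf_le SUP_upper \<delta>) auto
    then show "hausdorff_premeasure a \<delta> (\<Union>i. A i) \<le> (\<Sum>i. hausdorff_outer_measure a (A i))"
      using hausdorff_premeasure_countably_subadditive order_trans by blast
  qed
qed

lemma measure_space_hausdorff:
  "measure_space UNIV (lambda_system UNIV UNIV (hausdorff_outer_measure a))
     (hausdorff_outer_measure a)"
  using sigma_algebra.caratheodory_lemma
    [OF sigma_algebra_Pow, of UNIV "hausdorff_outer_measure a"] outer_measure_space_hausdorff[of a]
  by simp

lemma space_hausdorff_measure [simp]: "space (hausdorff_measure a) = UNIV"
  by (simp add: hausdorff_measure_def space_measure_of_conv)

lemma sigma_sets_lambda_system_hausdorff:
  "sigma_sets UNIV (lambda_system UNIV UNIV (hausdorff_outer_measure a)) =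
     lambda_system UNIV UNIV (hausdorff_outer_measure a)"
  using measure_space_hausdorff[of a] sigma_algebra.sigma_sets_eq
  unfolding measure_space_def by blast

lemma sets_hausdorff_measure:
  "sets (hausdorff_measure a) = lambda_system UNIV UNIV (hausdorff_outer_measure a)"
  by (simp add: hausdorff_measure_def sets_measure_of_conv sigma_sets_lambda_system_hausdorff)

lemma emeasure_hausdorff_measure:
  "A \<in> sets (hausdorff_measure a) \<Longrightarrow>
     emeasure (hausdorff_measure a) A = hausdorff_outer_measure a A"
  by (simp add: sets_hausdorff_measure)
    (simp add: hausdorff_measure_def emeasure_measure_of_conv sigma_sets_lambda_system_hausdorff
      measure_space_hausdorff)


section \<open>Nonlocal energies on a metric measure space\<close>

text \<open>Throughout, the metric measure space is the underlying set \<^term>\<open>space M\<close> of a measure \<open>M\<close>.\<close>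

definition Lp_space :: "'a measure \<Rightarrow> real \<Rightarrow> ('a \<Rightarrow> real) set" where
  "Lp_space M p = {u \<in> borel_measurable M. integrable M (\<lambda>x. \<bar>u x\<bar> powr p)}"

definition Lp_norm :: "'a measure \<Rightarrow> real \<Rightarrow> ('a \<Rightarrow> real) \<Rightarrow> real" where
  "Lp_norm M p u = (\<integral>x. \<bar>u x\<bar> powr p \<partial>M) powr (1 / p)"

text \<open>The \<open>p\<close>-th power of the seminorm, with values in \<open>[0, \<infinity>]\<close>.\<close>

definition seminorm_pow ::
  "'a::metric_space measure \<Rightarrow> real \<Rightarrow> real \<Rightarrow> real \<Rightarrow> ('a \<Rightarrow> real) \<Rightarrow> ennreal" where
  "seminorm_pow M \<alpha> s p u =
     (\<integral>\<^sup>+(x, y)\<in>{(x, y). x \<noteq> y}.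
        ennreal (\<bar>u x - u y\<bar> powr p / dist x y powr (\<alpha> + s * p)) \<partial>(M \<Otimes>\<^sub>M M))"

definition energy ::
  "'a::metric_space measure \<Rightarrow> real \<Rightarrow> real \<Rightarrow> real \<Rightarrow> ('a \<Rightarrow> real) \<Rightarrow> ennreal" where
  "energy M \<alpha> p s u = ennreal s * seminorm_pow M \<alpha> s p u"

definition energy_domain :: "'a::metric_space measure \<Rightarrow> real \<Rightarrow> real \<Rightarrow> ('a \<Rightarrow> real) set" where
  "energy_domain M \<alpha> p = (\<Union>s\<^sub>0\<in>{0<..<1}. {u \<in> Lp_space M p. seminorm_pow M \<alpha> s\<^sub>0 p u < \<infinity>})"


section \<open>Logarithmic averages of the volume growth\<close>

definition ball_volume :: "'a::metric_space measure \<Rightarrow> 'a \<Rightarrow> real \<Rightarrow> ennreal" where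
  "ball_volume M x r = emeasure M {y \<in> space M. dist x y \<le> r}"

definition log_density :: "'a::metric_space measure \<Rightarrow> real \<Rightarrow> 'a \<Rightarrow> real \<Rightarrow> ennreal" where
  "log_density M \<alpha> x t = ennreal (exp (- \<alpha> * t)) * ball_volume M x (exp t)"

definition log_average :: "'a::metric_space measure \<Rightarrow> real \<Rightarrow> 'a \<Rightarrow> real \<Rightarrow> ennreal" where
  "log_average M \<alpha> x T = (\<integral>\<^sup>+t\<in>{0..T}. log_density M \<alpha> x t \<partial>lborel) / ennreal T"

definition mean_density :: "'a::metric_space measure \<Rightarrow> real \<Rightarrow> 'a \<Rightarrow> ennreal" where
  "mean_density M \<alpha> x = Lim at_top (log_average M \<alpha> x)"


section \<open>The unbounded Sierpinski gasket\<close>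

definition sg_vertex :: "nat \<Rightarrow> real ^ 2" where
  "sg_vertex i = [vector [0, 0], vector [1, 0], vector [1 / 2, sqrt 3 / 2]] ! i"

definition sg_map :: "nat \<Rightarrow> real ^ 2 \<Rightarrow> real ^ 2" where
  "sg_map i z = (1 / 2) *\<^sub>R (z + sg_vertex i)"

definition sierpinski_gasket :: "(real ^ 2) set" where
  "sierpinski_gasket = (THE K. K \<noteq> {} \<and> compact K \<and> K = (\<Union>i\<in>{0..2}. sg_map i ` K))"

definition unbounded_sg :: "(real ^ 2) set" where
  "unbounded_sg = (\<Union>n::nat. (\<lambda>x. 2 ^ n *\<^sub>R x) ` sierpinski_gasket)"

definition sg_dim :: real where
  "sg_dim = ln 3 / ln 2"

definition sg_measure :: "(real ^ 2) measure" where
  "sg_measure = restrict_space (hausdorff_measure sg_dim) unbounded_sg"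

abbreviation sg_origin :: "real ^ 2" where
  "sg_origin \<equiv> sg_vertex 0"

definition sg_mean_density :: ennreal where
  "sg_mean_density = mean_density sg_measure sg_dim sg_origin"

end

theory Submission
  imports Defs
begin

text \<open>
  The energy is an integral over pairs, weighted by \<open>s * dist x y powr - (\<alpha> + s * p)\<close>.  For small
  \<open>s\<close> the factor \<open>s\<close> kills every part of the integral in which the distances stay bounded: below a
  radius \<open>R\<close> the kernel is at most a constant times the kernel of exponent \<open>s\<^sub>0\<close>, whose integral
  is finite.  What survives comes from pairs that are arbitrarily far apart.  If \<open>v\<close> vanishes outside a
  ball of radius \<open>n\<close>, then two points at a distance above \<open>2 * n\<close> cannot both lie in the support, so
  that \<open>\<bar>v x - v y\<bar> powr p = \<bar>v x\<bar> powr p + \<bar>v y\<bar> powr p\<close>; by symmetry the far energy is exactly twice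
  the integral of \<open>\<bar>v x\<bar> powr p\<close> against the tail integral of the kernel around \<open>x\<close>.  Hence the limit is
  \<open>2 * \<Lambda>\<close> times the integral of \<open>\<bar>u\<bar> powr p\<close>, provided that \<open>s\<close> times the tail integral tends to a
  number \<open>\<Lambda>\<close> that depends neither on the centre nor on the radius, and is bounded uniformly in the
  centre.  The passage from truncations to general \<open>u\<close> uses
  \<open>\<bar>a + b\<bar> powr p \<le> c * \<bar>a\<bar> powr p + d * \<bar>b\<bar> powr p\<close> with \<open>c\<close> as close to \<open>1\<close> as desired and the
  uniform bound for the remainder.  This general principle is \<open>energy_tendsto_of_tail\<close>.

  The rest is the verification for the gasket.  The Hausdorff outer measure is additive on separated
  sets, so Borel sets are measurable, and it scales by \<open>2 powr sg_dim = 3\<close> under the dilation by \<open>2\<close>,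
  which preserves the unbounded gasket.  Covering the gasket by its three half-size copies repeatedly
  shows that its measure is finite.  The unbounded gasket is contained in a union of lattice
  translates of the gasket, of which boundedly many meet a ball of a given size; with scaling this gives
  ball volumes of order at most \<open>3 ^ k\<close> at radius \<open>2 ^ k\<close>, uniformly in the centre, and hence the uniform
  bound for the tails.  Around the origin, the dyadic shells of the tail form an exact geometric series
  with ratio \<open>2 powr - (s * p)\<close>, so that \<open>\<Lambda>\<close> is the integral of \<open>norm y powr - sg_dim\<close> over the shell
  \<open>1 < norm y \<le> 2\<close>, divided by \<open>p * ln 2\<close>.  The kernels around two centres are asymptotically equal far
  away, which gives the same limit around every point.

  Scaling also makes the logarithmic density \<open>log_density\<close> at the origin periodic with period \<open>ln 2\<close>, so its averages
  converge to the mean over a period.  Writing that mean as a double integral and integrating over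
  \<open>t\<close> first turns it into the same shell integral (\<open>sg_period_integral_eq\<close>), which identifies \<open>\<Lambda>\<close>
  with \<open>sg_dim / p\<close> times the mean density.
\<close>

section \<open>Limits of extended nonnegative reals\<close>

lemma limsup_le_limit:
  fixes E :: "nat \<Rightarrow> ennreal"
  assumes "\<And>k. E k \<le> b k" "b \<longlonglongrightarrow> B"
  shows "limsup E \<le> B"
proof -
  have "limsup E \<le> limsup b" using assms(1) by (intro Limsup_mono) auto
  also have "\<dots> = B" using assms(2) by (intro lim_imp_Limsup) auto
  finally show ?thesis .
qed

lemma limit_le_liminf:
  fixes E :: "nat \<Rightarrow> ennreal"
  assumes c: "0 < c" and le: "\<And>k. a k \<le> ennreal c * E k + e k"
    and a: "a \<longlonglongrightarrow> A" and e: "e \<longlonglongrightarrow> e'" and fin: "A < top" "e' < top"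
  shows "A \<le> ennreal c * liminf E + e'"
proof -
  have cc: "ennreal (1 / c) * (ennreal c * x) = x" "ennreal c * (ennreal (1 / c) * x) = x" for x
    using c by (simp_all add: mult.assoc[symmetric] flip: ennreal_mult)
  have "ennreal (1 / c) * (a k - e k) \<le> E k" if "e k < top" for k
  proof -
    have "a k - e k \<le> ennreal c * E k"
      using le[of k] that by (auto simp: ennreal_minus_le_iff add.commute)
    then have "ennreal (1 / c) * (a k - e k) \<le> ennreal (1 / c) * (ennreal c * E k)"
      by (intro mult_left_mono) auto
    then show ?thesis by (simp add: cc)
  qed
  moreover have "eventually (\<lambda>k. e k < top) sequentially" using e fin by (simp add: order_tendstoD)
  ultimately have "eventually (\<lambda>k. ennreal (1 / c) * (a k - e k) \<le> E k) sequentially"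
    by (auto elim: eventually_mono)
  then have "liminf (\<lambda>k. ennreal (1 / c) * (a k - e k)) \<le> liminf E" by (rule Liminf_mono)
  moreover have "(\<lambda>k. ennreal (1 / c) * (a k - e k)) \<longlonglongrightarrow> ennreal (1 / c) * (A - e')"
    using fin by (intro ennreal_tendsto_cmult tendsto_diff_ennreal a e) auto
  then have "liminf (\<lambda>k. ennreal (1 / c) * (a k - e k)) = ennreal (1 / c) * (A - e')"
    by (intro lim_imp_Liminf) auto
  ultimately have "ennreal c * (ennreal (1 / c) * (A - e')) \<le> ennreal c * liminf E"
    by (intro mult_left_mono) auto
  then have "A - e' \<le> ennreal c * liminf E" by (simp add: cc)
  then show ?thesis using fin by (simp add: ennreal_minus_le_iff add.commute)
qed

text \<open>
  The form in which all limits below are obtained: both the truncation of a function and the change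
  of the centre of a tail integral lose a factor \<open>c\<close> that can be taken arbitrarily close to \<open>1\<close>.
\<close>

lemma tendsto_ennreal_sandwich:
  fixes E :: "nat \<Rightarrow> ennreal"
  assumes L: "L < top"
    and up: "\<And>c::real. 1 < c \<Longrightarrow> limsup E \<le> ennreal c * L"
    and lo: "\<And>c::real. 1 < c \<Longrightarrow> L \<le> ennreal c * liminf E"
  shows "E \<longlonglongrightarrow> L"
proof -
  have lim: "(\<lambda>n. ennreal (1 + inverse (Suc n)) * x) \<longlonglongrightarrow> x" if "x < top" for x
  proof -
    have "(\<lambda>n. 1 + inverse (real (Suc n))) \<longlonglongrightarrow> 1 + 0"
      by (intro tendsto_add tendsto_const LIMSEQ_inverse_real_of_nat)
    then have "(\<lambda>n. x * ennreal (1 + inverse (Suc n))) \<longlonglongrightarrow> x * ennreal (1 + 0)"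
      by (intro ennreal_tendsto_cmult that tendsto_ennrealI)
    then show ?thesis by (simp add: mult.commute)
  qed
  have 1: "limsup E \<le> L"
    by (rule LIMSEQ_le_const[OF lim[OF L]]) (intro exI[of _ 0] allI impI up, simp)
  have 2: "L \<le> liminf E"
  proof (cases "liminf E < top")
    case True
    show ?thesis by (rule LIMSEQ_le_const[OF lim[OF True]]) (intro exI[of _ 0] allI impI lo, simp)
  qed (simp add: not_less top_unique)
  have "liminf E \<le> limsup E" by (rule Liminf_le_Limsup) simp
  with 1 2 have "liminf E = L" "limsup E = L" by auto
  then show ?thesis by (intro iffD2[OF tendsto_iff_Liminf_eq_Limsup]) auto
qed

section \<open>Nonlocal energies for small exponents\<close>

text \<open>
  A triangle inequality with a constant close to \<open>1\<close> in front of the main term.  Either \<open>b\<close> is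
  small relative to \<open>a\<close>, and the sum exceeds \<open>a\<close> by a factor close to \<open>1\<close>, or \<open>a\<close> is bounded by a
  multiple of \<open>b\<close>.
\<close>

lemma abs_add_powr_le:
  fixes p c :: real
  assumes p: "0 < p" and c: "1 < c"
  shows "\<exists>d\<ge>0. \<forall>a b. \<bar>a + b\<bar> powr p \<le> c * \<bar>a\<bar> powr p + d * \<bar>b\<bar> powr p"
proof -
  define \<delta> where "\<delta> = c powr (1 / p) - 1"
  have \<delta>: "0 < \<delta>" using p c by (simp add: \<delta>_def gr_one_powr)
  have c': "(1 + \<delta>) powr p = c" using p c by (simp add: \<delta>_def powr_powr)
  have "\<bar>a + b\<bar> powr p \<le> c * \<bar>a\<bar> powr p + (1 + 1 / \<delta>) powr p * \<bar>b\<bar> powr p" for a b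
  proof (cases "\<bar>b\<bar> \<le> \<delta> * \<bar>a\<bar>")
    case True
    have "\<bar>a + b\<bar> powr p \<le> ((1 + \<delta>) * \<bar>a\<bar>) powr p"
      using True p by (intro powr_mono2) (auto simp: algebra_simps)
    also have "\<dots> = c * \<bar>a\<bar> powr p" using \<delta> c' by (simp add: powr_mult)
    finally show ?thesis by (simp add: add_increasing2)
  next
    case False
    then have "\<bar>a\<bar> \<le> \<bar>b\<bar> / \<delta>" using \<delta> by (simp add: field_simps)
    then have "\<bar>a + b\<bar> powr p \<le> ((1 + 1 / \<delta>) * \<bar>b\<bar>) powr p"
      using p by (intro powr_mono2) (auto simp: algebra_simps)
    also have "\<dots> = (1 + 1 / \<delta>) powr p * \<bar>b\<bar> powr p" using \<delta> by (simp add: powr_mult)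
    finally show ?thesis using c by (simp add: add_increasing)
  qed
  then show ?thesis by (intro exI[of _ "(1 + 1 / \<delta>) powr p"]) auto
qed

definition far_kernel :: "real \<Rightarrow> real \<Rightarrow> 'a::metric_space \<Rightarrow> 'a \<Rightarrow> ennreal" where
  "far_kernel \<beta> R x y = (if R < dist x y then ennreal (dist x y powr - \<beta>) else 0)"

definition tail_integral :: "'a::metric_space measure \<Rightarrow> real \<Rightarrow> real \<Rightarrow> 'a \<Rightarrow> ennreal" where
  "tail_integral M \<beta> R x = (\<integral>\<^sup>+y. far_kernel \<beta> R x y \<partial>M)"

definition far_energy ::
  "'a::metric_space measure \<Rightarrow> real \<Rightarrow> real \<Rightarrow> real \<Rightarrow> ('a \<Rightarrow> real) \<Rightarrow> ennreal" where
  "far_energy M \<beta> p R v = (\<integral>\<^sup>+x. \<integral>\<^sup>+y. ennreal (\<bar>v x - v y\<bar> powr p) * far_kernel \<beta> R x y \<partial>M \<partial>M)"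

lemma tail_integral_antimono: "R \<le> R' \<Longrightarrow> tail_integral M \<beta> R' x \<le> tail_integral M \<beta> R x"
  unfolding tail_integral_def by (intro nn_integral_mono) (auto simp: far_kernel_def)

context
  fixes M :: "'a::{metric_space, second_countable_topology} measure"
  assumes sf: "sigma_finite_measure M" and ident [measurable]: "(\<lambda>x. x) \<in> M \<rightarrow>\<^sub>M borel"
begin

interpretation sigma_finite_measure M by (rule sf)

lemma measurable_dist_pair [measurable]: "(\<lambda>z. dist (fst z) (snd z)) \<in> borel_measurable (M \<Otimes>\<^sub>M M)"
proof -
  have [measurable]: "fst \<in> M \<Otimes>\<^sub>M M \<rightarrow>\<^sub>M borel" "snd \<in> M \<Otimes>\<^sub>M M \<rightarrow>\<^sub>M borel"
    using measurable_compose[OF measurable_fst ident] measurable_compose[OF measurable_snd ident] by auto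
  show ?thesis by measurable
qed

lemma measurable_far_kernel [measurable]:
  "(\<lambda>z. far_kernel \<beta> R (fst z) (snd z)) \<in> borel_measurable (M \<Otimes>\<^sub>M M)"
  unfolding far_kernel_def by measurable

lemma measurable_tail_integral [measurable]: "tail_integral M \<beta> R \<in> borel_measurable M"
  unfolding tail_integral_def[abs_def] by (intro borel_measurable_nn_integral) (simp add: case_prod_beta')

lemma seminorm_pow_iterated:
  assumes [measurable]: "u \<in> borel_measurable M"
  shows "seminorm_pow M \<alpha> s p u =
     (\<integral>\<^sup>+x. \<integral>\<^sup>+y. ennreal (\<bar>u x - u y\<bar> powr p * dist x y powr - (\<alpha> + s * p)) \<partial>M \<partial>M)"
proof -
  have "seminorm_pow M \<alpha> s p u =
    (\<integral>\<^sup>+z. ennreal (\<bar>u (fst z) - u (snd z)\<bar> powr p * dist (fst z) (snd z) powr - (\<alpha> + s * p)) \<partial>(M \<Otimes>\<^sub>M M))"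
    unfolding seminorm_pow_def
    by (intro nn_integral_cong) (auto simp: indicator_def powr_minus_divide simp del: minus_add_distrib split: prod.split)
  also have "\<dots> = (\<integral>\<^sup>+x. \<integral>\<^sup>+y. ennreal (\<bar>u x - u y\<bar> powr p * dist x y powr - (\<alpha> + s * p)) \<partial>M \<partial>M)"
  proof -
    have "(\<lambda>z. ennreal (\<bar>u (fst z) - u (snd z)\<bar> powr p * dist (fst z) (snd z) powr - (\<alpha> + s * p)))
        \<in> borel_measurable (M \<Otimes>\<^sub>M M)" by measurable
    from nn_integral_fst[OF this] show ?thesis by simp
  qed
  finally show ?thesis .
qed

text \<open>
  The kernel is symmetric, so the two summands contribute equally by Tonelli's theorem.
\<close>

lemma nn_integral_sum_far_kernel:
  fixes w :: "'a \<Rightarrow> ennreal"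
  assumes [measurable]: "w \<in> borel_measurable M"
  shows "(\<integral>\<^sup>+x. \<integral>\<^sup>+y. (w x + w y) * far_kernel \<beta> R x y \<partial>M \<partial>M)
       = 2 * (\<integral>\<^sup>+x. w x * tail_integral M \<beta> R x \<partial>M)"
proof -
  let ?K = "far_kernel \<beta> R"
  have m1: "(\<lambda>(x, y). w x * ?K x y) \<in> borel_measurable (M \<Otimes>\<^sub>M M)"
    and m2: "(\<lambda>(x, y). w y * ?K x y) \<in> borel_measurable (M \<Otimes>\<^sub>M M)"
    unfolding case_prod_beta' by measurable
  have Kx [measurable]: "?K x \<in> borel_measurable M" if "x \<in> space M" for x
    using measurable_Pair2[OF measurable_far_kernel[of \<beta> R] that] by simp
  have tail: "(\<integral>\<^sup>+y. c * ?K x y \<partial>M) = c * tail_integral M \<beta> R x" if "x \<in> space M" for c x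
    unfolding tail_integral_def by (rule nn_integral_cmult[OF Kx[OF that]])
  have "(\<integral>\<^sup>+x. \<integral>\<^sup>+y. (w x + w y) * ?K x y \<partial>M \<partial>M)
      = (\<integral>\<^sup>+x. (\<integral>\<^sup>+y. w x * ?K x y \<partial>M) + (\<integral>\<^sup>+y. w y * ?K x y \<partial>M) \<partial>M)"
    using Kx assms by (intro nn_integral_cong) (simp add: distrib_right nn_integral_add borel_measurable_times_ennreal)
  also have "\<dots> = (\<integral>\<^sup>+x. \<integral>\<^sup>+y. w x * ?K x y \<partial>M \<partial>M) + (\<integral>\<^sup>+x. \<integral>\<^sup>+y. w y * ?K x y \<partial>M \<partial>M)"
    using m1 m2 by (intro nn_integral_add borel_measurable_nn_integral)
  also have "(\<integral>\<^sup>+x. \<integral>\<^sup>+y. w y * ?K x y \<partial>M \<partial>M) = (\<integral>\<^sup>+y. \<integral>\<^sup>+x. w y * ?K x y \<partial>M \<partial>M)"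
    using pair_sigma_finite.Fubini'[of M M, OF _ m2] sf by (simp add: pair_sigma_finite_def)
  also have "\<dots> = (\<integral>\<^sup>+x. \<integral>\<^sup>+y. w x * ?K x y \<partial>M \<partial>M)"
    by (intro nn_integral_cong) (simp add: far_kernel_def dist_commute)
  also have "(\<integral>\<^sup>+x. \<integral>\<^sup>+y. w x * ?K x y \<partial>M \<partial>M) = (\<integral>\<^sup>+x. w x * tail_integral M \<beta> R x \<partial>M)"
    by (intro nn_integral_cong tail)
  finally show ?thesis by (simp only: mult_2)
qed

lemma far_energy_le:
  assumes v [measurable]: "v \<in> borel_measurable M" and p: "0 < p"
  shows "far_energy M \<beta> p R v \<le>
    2 * (\<integral>\<^sup>+x. ennreal (2 powr p * \<bar>v x\<bar> powr p) * tail_integral M \<beta> R x \<partial>M)"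
proof -
  have "\<bar>a - b\<bar> powr p \<le> 2 powr p * \<bar>a\<bar> powr p + 2 powr p * \<bar>b\<bar> powr p" for a b :: real
  proof -
    have "\<bar>a - b\<bar> powr p \<le> (2 * max \<bar>a\<bar> \<bar>b\<bar>) powr p" using p by (intro powr_mono2) auto
    also have "\<dots> = 2 powr p * max \<bar>a\<bar> \<bar>b\<bar> powr p" by (simp add: powr_mult)
    also have "\<dots> \<le> 2 powr p * \<bar>a\<bar> powr p + 2 powr p * \<bar>b\<bar> powr p" by (auto simp: max_def)
    finally show ?thesis .
  qed
  then have le: "ennreal (\<bar>a - b\<bar> powr p) \<le> ennreal (2 powr p * \<bar>a\<bar> powr p) + ennreal (2 powr p * \<bar>b\<bar> powr p)" for a b
    by (simp add: ennreal_leI flip: ennreal_plus)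
  have "far_energy M \<beta> p R v \<le> (\<integral>\<^sup>+x. \<integral>\<^sup>+y.
      (ennreal (2 powr p * \<bar>v x\<bar> powr p) + ennreal (2 powr p * \<bar>v y\<bar> powr p)) * far_kernel \<beta> R x y \<partial>M \<partial>M)"
    unfolding far_energy_def by (intro nn_integral_mono mult_right_mono le) simp
  also have "\<dots> = 2 * (\<integral>\<^sup>+x. ennreal (2 powr p * \<bar>v x\<bar> powr p) * tail_integral M \<beta> R x \<partial>M)"
    by (rule nn_integral_sum_far_kernel) measurable
  finally show ?thesis .
qed

text \<open>
  Two points at a distance above \<open>2 * r\<close> do not both lie in the ball of radius \<open>r\<close> about \<open>z\<close>: the
  cross terms vanish and the energy splits exactly.  This replaces any expansion of
  \<open>\<bar>v x - v y\<bar> powr p\<close>.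
\<close>

lemma far_energy_bounded_support:
  assumes v: "v \<in> borel_measurable M" and supp: "\<And>x. r < dist z x \<Longrightarrow> v x = 0"
  shows "far_energy M \<beta> p (2 * r) v = 2 * (\<integral>\<^sup>+x. ennreal (\<bar>v x\<bar> powr p) * tail_integral M \<beta> (2 * r) x \<partial>M)"
proof -
  have "far_energy M \<beta> p (2 * r) v = (\<integral>\<^sup>+x. \<integral>\<^sup>+y.
      (ennreal (\<bar>v x\<bar> powr p) + ennreal (\<bar>v y\<bar> powr p)) * far_kernel \<beta> (2 * r) x y \<partial>M \<partial>M)"
    unfolding far_energy_def
  proof (intro nn_integral_cong)
  fix x y
  have "v x = 0 \<or> v y = 0" if "2 * r < dist x y"
    using dist_triangle2[of x y z] supp[of x] supp[of y] that
    by (cases "r < dist z x") (auto simp: dist_commute[of _ z])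
  then show "ennreal (\<bar>v x - v y\<bar> powr p) * far_kernel \<beta> (2 * r) x y =
     (ennreal (\<bar>v x\<bar> powr p) + ennreal (\<bar>v y\<bar> powr p)) *
       far_kernel \<beta> (2 * r) x y"
    by (auto simp: far_kernel_def)
  qed
  also have "\<dots> = 2 * (\<integral>\<^sup>+x. ennreal (\<bar>v x\<bar> powr p) * tail_integral M \<beta> (2 * r) x \<partial>M)"
    using v by (intro nn_integral_sum_far_kernel) measurable
  finally show ?thesis .
qed

lemma far_energy_add_le:
  assumes v [measurable]: "v \<in> borel_measurable M" and w [measurable]: "w \<in> borel_measurable M"
    and cd: "0 \<le> c" "0 \<le> d" "\<And>a b. \<bar>a + b\<bar> powr p \<le> c * \<bar>a\<bar> powr p + d * \<bar>b\<bar> powr p"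
  shows "far_energy M \<beta> p R (\<lambda>x. v x + w x) \<le>
    ennreal c * far_energy M \<beta> p R v + ennreal d * far_energy M \<beta> p R w"
proof -
  let ?f = "\<lambda>v x y. ennreal (\<bar>v x - v y\<bar> powr p) * far_kernel \<beta> R x y"
  have m: "(\<lambda>(x, y). ?f h x y) \<in> borel_measurable (M \<Otimes>\<^sub>M M)" if "h \<in> borel_measurable M" for h
    using that unfolding case_prod_beta' by measurable
  have mx: "?f h x \<in> borel_measurable M" if "h \<in> borel_measurable M" "x \<in> space M" for h x
    using measurable_Pair2[OF m[OF that(1)] that(2)] by simp
  have "?f (\<lambda>x. v x + w x) x y \<le> ennreal c * ?f v x y + ennreal d * ?f w x y" for x y
  proof -
    have "\<bar>v x + w x - (v y + w y)\<bar> powr p \<le> c * \<bar>v x - v y\<bar> powr p + d * \<bar>w x - w y\<bar> powr p"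
      using cd(3)[of "v x - v y" "w x - w y"] by (simp add: algebra_simps)
    then have "ennreal (\<bar>v x + w x - (v y + w y)\<bar> powr p)
        \<le> ennreal c * ennreal (\<bar>v x - v y\<bar> powr p) + ennreal d * ennreal (\<bar>w x - w y\<bar> powr p)"
      using cd by (simp add: ennreal_leI flip: ennreal_plus ennreal_mult)
    then have "?f (\<lambda>x. v x + w x) x y \<le> (ennreal c * ennreal (\<bar>v x - v y\<bar> powr p) + ennreal d * ennreal (\<bar>w x - w y\<bar> powr p)) * far_kernel \<beta> R x y"
      by (rule mult_right_mono) simp
    then show ?thesis by (simp add: distrib_right mult.assoc)
  qed
  then have "far_energy M \<beta> p R (\<lambda>x. v x + w x)
      \<le> (\<integral>\<^sup>+x. \<integral>\<^sup>+y. ennreal c * ?f v x y + ennreal d * ?f w x y \<partial>M \<partial>M)"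
    unfolding far_energy_def by (intro nn_integral_mono)
  also have "\<dots> = (\<integral>\<^sup>+x. ennreal c * (\<integral>\<^sup>+y. ?f v x y \<partial>M) + ennreal d * (\<integral>\<^sup>+y. ?f w x y \<partial>M) \<partial>M)"
    using mx[OF v] mx[OF w] by (intro nn_integral_cong) (simp add: nn_integral_add nn_integral_cmult borel_measurable_times_ennreal)
  also have "\<dots> = ennreal c * far_energy M \<beta> p R v + ennreal d * far_energy M \<beta> p R w"
    using borel_measurable_nn_integral[OF m[OF v]] borel_measurable_nn_integral[OF m[OF w]]
    unfolding far_energy_def by (simp add: nn_integral_add nn_integral_cmult borel_measurable_times_ennreal)
  finally show ?thesis .
qed

lemma far_energy_le_seminorm_pow:
  assumes "u \<in> borel_measurable M"
  shows "far_energy M (\<alpha> + s * p) p R u \<le> seminorm_pow M \<alpha> s p u"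
  unfolding far_energy_def seminorm_pow_iterated[OF assms]
  by (intro nn_integral_mono) (auto simp: far_kernel_def ennreal_mult)

text \<open>
  Near the diagonal the kernel of exponent \<open>s\<close> is controlled by the one of the larger exponent
  \<open>s\<^sub>0\<close>.  The constant \<open>R powr (s\<^sub>0 * p)\<close> does not depend on \<open>s\<close>, so a factor \<open>s\<close> makes this part
  negligible.
\<close>

lemma seminorm_pow_le_far_energy:
  assumes u [measurable]: "u \<in> borel_measurable M" and p: "0 < p" and s: "0 < s" "s < s\<^sub>0" and R: "1 \<le> R"
  shows "seminorm_pow M \<alpha> s p u \<le> far_energy M (\<alpha> + s * p) p R u
      + ennreal (R powr (s\<^sub>0 * p)) * seminorm_pow M \<alpha> s\<^sub>0 p u"
proof -
  let ?f = "\<lambda>x y. ennreal (\<bar>u x - u y\<bar> powr p) * far_kernel (\<alpha> + s * p) R x y"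
  let ?g = "\<lambda>x y. ennreal (\<bar>u x - u y\<bar> powr p * dist x y powr - (\<alpha> + s\<^sub>0 * p))"
  have m: "(\<lambda>(x, y). ?f x y) \<in> borel_measurable (M \<Otimes>\<^sub>M M)" "(\<lambda>(x, y). ?g x y) \<in> borel_measurable (M \<Otimes>\<^sub>M M)"
    unfolding case_prod_beta' by measurable
  have mx: "?f x \<in> borel_measurable M" "?g x \<in> borel_measurable M" if "x \<in> space M" for x
    using measurable_Pair2[OF m(1) that] measurable_Pair2[OF m(2) that] by simp_all
  have "ennreal (\<bar>u x - u y\<bar> powr p * dist x y powr - (\<alpha> + s * p)) \<le> ?f x y + ennreal (R powr (s\<^sub>0 * p)) * ?g x y" for x y
  proof (cases "R < dist x y \<or> x = y")
    case False
    then have d: "0 < dist x y" "dist x y \<le> R" by auto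
    have "dist x y powr - (\<alpha> + s * p) = dist x y powr ((s\<^sub>0 - s) * p) * dist x y powr - (\<alpha> + s\<^sub>0 * p)"
      using d by (simp add: algebra_simps flip: powr_add)
    also have "dist x y powr ((s\<^sub>0 - s) * p) \<le> R powr ((s\<^sub>0 - s) * p)"
      using d p s by (intro powr_mono2) auto
    also have "\<dots> \<le> R powr (s\<^sub>0 * p)"
      using R p s by (intro powr_mono mult_right_mono) auto
    finally have "dist x y powr - (\<alpha> + s * p) \<le> R powr (s\<^sub>0 * p) * dist x y powr - (\<alpha> + s\<^sub>0 * p)"
      by (simp add: mult_right_mono)
    then have "\<bar>u x - u y\<bar> powr p * dist x y powr - (\<alpha> + s * p)
        \<le> \<bar>u x - u y\<bar> powr p * (R powr (s\<^sub>0 * p) * dist x y powr - (\<alpha> + s\<^sub>0 * p))"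
      by (intro mult_left_mono) auto
    then have "ennreal (\<bar>u x - u y\<bar> powr p * dist x y powr - (\<alpha> + s * p)) \<le> ennreal (R powr (s\<^sub>0 * p)) * ?g x y"
      by (simp add: ennreal_leI mult.left_commute flip: ennreal_mult)
    then show ?thesis by (simp add: add_increasing)
  qed (auto simp: far_kernel_def ennreal_mult add_increasing2)
  then have "seminorm_pow M \<alpha> s p u \<le> (\<integral>\<^sup>+x. \<integral>\<^sup>+y. ?f x y + ennreal (R powr (s\<^sub>0 * p)) * ?g x y \<partial>M \<partial>M)"
    unfolding seminorm_pow_iterated[OF u] by (intro nn_integral_mono)
  also have "\<dots> = (\<integral>\<^sup>+x. (\<integral>\<^sup>+y. ?f x y \<partial>M) + ennreal (R powr (s\<^sub>0 * p)) * (\<integral>\<^sup>+y. ?g x y \<partial>M) \<partial>M)"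
    using mx by (intro nn_integral_cong) (simp add: nn_integral_add nn_integral_cmult borel_measurable_times_ennreal)
  also have "\<dots> = far_energy M (\<alpha> + s * p) p R u + ennreal (R powr (s\<^sub>0 * p)) * seminorm_pow M \<alpha> s\<^sub>0 p u"
    using borel_measurable_nn_integral[OF m(1)] borel_measurable_nn_integral[OF m(2)]
    unfolding far_energy_def seminorm_pow_iterated[OF u]
    by (simp add: nn_integral_add nn_integral_cmult borel_measurable_times_ennreal)
  finally show ?thesis .
qed
end

text \<open>
  The principle behind the theorem, for \<open>\<sigma>\<close>-finite measures on a separable metric space.  The energy is compared with the energy of the truncation \<open>v n\<close> of \<open>u\<close> to a ball of radius
  \<open>n\<close>, for which the limit is computed by dominated convergence; the remainder \<open>W n\<close> tends to \<open>0\<close>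
  and is controlled by the uniform bound for the tails.
\<close>

theorem energy_tendsto_of_tail:
  fixes M :: "'a::{metric_space, second_countable_topology} measure"
  assumes sf: "sigma_finite_measure M" and ident: "(\<lambda>x. x) \<in> M \<rightarrow>\<^sub>M borel"
    and p: "0 < p" and \<Lambda>: "\<Lambda> < top"
    and tail: "\<And>x R. x \<in> space M \<Longrightarrow> 0 < R \<Longrightarrow>
      ((\<lambda>s. ennreal s * tail_integral M (\<alpha> + s * p) R x) \<longlongrightarrow> \<Lambda>) (at_right 0)"
    and bound: "eventually (\<lambda>s. \<forall>x\<in>space M. ennreal s * tail_integral M (\<alpha> + s * p) 1 x \<le> ennreal C) (at_right 0)"
    and u: "u \<in> energy_domain M \<alpha> p"
  shows "((\<lambda>s. energy M \<alpha> p s u) \<longlongrightarrow> 2 * \<Lambda> * (\<integral>\<^sup>+x. ennreal (\<bar>u x\<bar> powr p) \<partial>M)) (at_right 0)"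
proof -
  obtain s\<^sub>0 where s0: "0 < s\<^sub>0" and um [measurable]: "u \<in> borel_measurable M"
    and int: "integrable M (\<lambda>x. \<bar>u x\<bar> powr p)" and fin: "seminorm_pow M \<alpha> s\<^sub>0 p u < top"
    using u by (auto simp: energy_domain_def Lp_space_def)
  define I where "I v = (\<integral>\<^sup>+x. ennreal (\<bar>v x\<bar> powr p) \<partial>M)" for v :: "'a \<Rightarrow> real"
  have I_fin: "I u < top"
    using int by (auto simp: I_def integrable_iff_bounded)
  from bound obtain b0 where b0: "0 < b0"
    "\<And>s x. 0 < s \<Longrightarrow> s < b0 \<Longrightarrow> x \<in> space M \<Longrightarrow> ennreal s * tail_integral M (\<alpha> + s * p) 1 x \<le> ennreal C"
    unfolding eventually_at_right_field by blast
  define b where "b = min b0 s\<^sub>0"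
  have b: "0 < b" using b0 s0 by (simp add: b_def)
  have "(\<lambda>k. energy M \<alpha> p (s k) u) \<longlonglongrightarrow> 2 * \<Lambda> * I u"
    if s: "\<And>k. 0 < s k" "\<And>k. s k < b" "s \<longlonglongrightarrow> 0" for s :: "nat \<Rightarrow> real"
  proof -
    define E where "E k = energy M \<alpha> p (s k) u" for k
    define F where "F R v k = ennreal (s k) * far_energy M (\<alpha> + s k * p) p R v" for R v k
    have ss0: "s k < s\<^sub>0" "s k < b0" for k using s(2)[of k] by (auto simp: b_def)
    have sr: "filterlim s (at_right 0) sequentially"
      using s s(1)[THEN less_imp_neq] by (auto simp: filterlim_at)
    have s0': "(\<lambda>k. ennreal (s k)) \<longlonglongrightarrow> 0" using tendsto_ennrealI[OF s(3)] by simp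
    define N where "N R k = ennreal (s k) * (ennreal (R powr (s\<^sub>0 * p)) * seminorm_pow M \<alpha> s\<^sub>0 p u)" for R k
    have N0: "N R \<longlonglongrightarrow> 0" for R
    proof -
      have "(\<lambda>k. ennreal (R powr (s\<^sub>0 * p)) * seminorm_pow M \<alpha> s\<^sub>0 p u * ennreal (s k))
          \<longlonglongrightarrow> ennreal (R powr (s\<^sub>0 * p)) * seminorm_pow M \<alpha> s\<^sub>0 p u * 0"
        using fin by (intro ennreal_tendsto_cmult s0') (auto simp: ennreal_mult_less_top)
      then show ?thesis by (simp add: N_def[abs_def] mult.commute)
    qed
    have F_le_E: "F R u k \<le> E k" for R k
      unfolding F_def E_def energy_def
      by (intro mult_left_mono far_energy_le_seminorm_pow[OF sf ident um]) simp
    have E_le_F: "E k \<le> F R u k + N R k" if "1 \<le> R" for R k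
      unfolding F_def E_def energy_def N_def distrib_left[symmetric]
      by (intro mult_left_mono seminorm_pow_le_far_energy[OF sf ident um p s(1) ss0(1) that]) simp
    have tail_le: "ennreal (s k) * tail_integral M (\<alpha> + s k * p) R x \<le> ennreal C"
      if "1 \<le> R" "x \<in> space M" for R x k
      using b0(2)[OF s(1) ss0(2) that(2)] tail_integral_antimono[OF that(1), of M "\<alpha> + s k * p" x]
      by (meson mult_left_mono order_trans zero_le)
    have weighted: "ennreal (s k) * (2 * (\<integral>\<^sup>+x. w x * tail_integral M (\<alpha> + s k * p) R x \<partial>M))
        = 2 * (\<integral>\<^sup>+x. w x * (ennreal (s k) * tail_integral M (\<alpha> + s k * p) R x) \<partial>M)"
      if [measurable]: "w \<in> borel_measurable M" for w :: "'a \<Rightarrow> ennreal" and R k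
    proof -
      have [measurable]: "tail_integral M (\<alpha> + s k * p) R \<in> borel_measurable M"
        by (rule measurable_tail_integral[OF sf ident])
      have "(\<integral>\<^sup>+x. w x * (ennreal (s k) * tail_integral M (\<alpha> + s k * p) R x) \<partial>M)
          = (\<integral>\<^sup>+x. ennreal (s k) * (w x * tail_integral M (\<alpha> + s k * p) R x) \<partial>M)"
        by (simp add: mult.left_commute)
      also have "\<dots> = ennreal (s k) * (\<integral>\<^sup>+x. w x * tail_integral M (\<alpha> + s k * p) R x \<partial>M)"
        by (rule nn_integral_cmult) measurable
      finally show ?thesis by (simp add: mult.left_commute)
    qed
    define D where "D = 2 * ennreal (2 powr p) * ennreal C"
    have D_fin: "D < top" by (auto simp: D_def ennreal_mult_less_top)
    have F_bound: "F R v k \<le> D * I v" if "1 \<le> R" and v [measurable]: "v \<in> borel_measurable M" for R v k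
    proof -
      have "F R v k \<le> ennreal (s k) * (2 * (\<integral>\<^sup>+x. ennreal (2 powr p * \<bar>v x\<bar> powr p) * tail_integral M (\<alpha> + s k * p) R x \<partial>M))"
        unfolding F_def by (intro mult_left_mono far_energy_le[OF sf ident v p]) simp
      also have "\<dots> = 2 * (\<integral>\<^sup>+x. ennreal (2 powr p * \<bar>v x\<bar> powr p) * (ennreal (s k) * tail_integral M (\<alpha> + s k * p) R x) \<partial>M)"
        by (rule weighted) measurable
      also have "\<dots> \<le> 2 * (\<integral>\<^sup>+x. ennreal (2 powr p * \<bar>v x\<bar> powr p) * ennreal C \<partial>M)"
        by (intro mult_left_mono nn_integral_mono tail_le that) simp_all
      also have "\<dots> = 2 * (\<integral>\<^sup>+x. (ennreal (2 powr p) * ennreal C) * ennreal (\<bar>v x\<bar> powr p) \<partial>M)"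
        by (simp add: ennreal_mult mult_ac)
      also have "(\<integral>\<^sup>+x. (ennreal (2 powr p) * ennreal C) * ennreal (\<bar>v x\<bar> powr p) \<partial>M)
          = (ennreal (2 powr p) * ennreal C) * I v"
        unfolding I_def by (rule nn_integral_cmult) measurable
      finally show ?thesis by (simp add: D_def mult_ac)
    qed
    \<comment> \<open>Any point of the type can be the centre of the truncation, even one outside the space of \<open>M\<close>.\<close>
    define z :: 'a where "z = undefined"
    define v where "v n x = (if dist z x \<le> real n then u x else 0)" for n :: nat and x
    have vm [measurable]: "v n \<in> borel_measurable M" for n
    proof -
      have [measurable]: "(\<lambda>x. dist z x) \<in> borel_measurable M"
        using measurable_compose[OF ident, of "dist z" borel] by simp
      show ?thesis unfolding v_def[abs_def] by measurable
    qed
    have Iv_le: "I (v n) \<le> I u" for n unfolding I_def v_def by (intro nn_integral_mono) auto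
    have Iv_fin: "I (v n) < top" for n using Iv_le[of n] I_fin by (rule order_le_less_trans)
    have F_v: "F (2 * real n) (v n) \<longlonglongrightarrow> 2 * \<Lambda> * I (v n)" if n: "1 \<le> n" for n
    proof -
      let ?T = "\<lambda>k x. ennreal (s k) * tail_integral M (\<alpha> + s k * p) (2 * real n) x"
      have [measurable]: "tail_integral M (\<alpha> + s k * p) (2 * real n) \<in> borel_measurable M" for k
        by (rule measurable_tail_integral[OF sf ident])
      have F_eq: "F (2 * real n) (v n) k = 2 * (\<integral>\<^sup>+x. ennreal (\<bar>v n x\<bar> powr p) * ?T k x \<partial>M)" for k
      proof -
        have "far_energy M (\<alpha> + s k * p) p (2 * real n) (v n) =
            2 * (\<integral>\<^sup>+x. ennreal (\<bar>v n x\<bar> powr p) * tail_integral M (\<alpha> + s k * p) (2 * real n) x \<partial>M)"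
          by (rule far_energy_bounded_support[OF sf ident vm, of "real n" z]) (simp add: v_def)
        then show ?thesis unfolding F_def by (simp add: weighted)
      qed
      have "(\<lambda>k. \<integral>\<^sup>+x. ennreal (\<bar>v n x\<bar> powr p) * ?T k x \<partial>M) \<longlonglongrightarrow> (\<integral>\<^sup>+x. ennreal (\<bar>v n x\<bar> powr p) * \<Lambda> \<partial>M)"
      proof (rule nn_integral_dominated_convergence)
        show "AE x in M. ennreal (\<bar>v n x\<bar> powr p) * ?T k x \<le> ennreal C * ennreal (\<bar>v n x\<bar> powr p)" for k
          using n by (subst mult.commute[of "ennreal C"]) (intro AE_I2 mult_left_mono tail_le, auto)
        have "(\<integral>\<^sup>+x. ennreal C * ennreal (\<bar>v n x\<bar> powr p) \<partial>M) = ennreal C * I (v n)"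
          unfolding I_def by (rule nn_integral_cmult) measurable
        also have "\<dots> < top" using Iv_fin[of n] by (simp add: ennreal_mult_less_top)
        finally show "(\<integral>\<^sup>+x. ennreal C * ennreal (\<bar>v n x\<bar> powr p) \<partial>M) < \<infinity>" by simp
        show "AE x in M. (\<lambda>k. ennreal (\<bar>v n x\<bar> powr p) * ?T k x) \<longlonglongrightarrow> ennreal (\<bar>v n x\<bar> powr p) * \<Lambda>"
          using n by (intro AE_I2 ennreal_tendsto_cmult filterlim_compose[OF tail sr]) auto
      qed measurable
      also have "(\<integral>\<^sup>+x. ennreal (\<bar>v n x\<bar> powr p) * \<Lambda> \<partial>M) = I (v n) * \<Lambda>"
        unfolding I_def by (rule nn_integral_multc) measurable
      finally have "(\<lambda>k. 2 * (\<integral>\<^sup>+x. ennreal (\<bar>v n x\<bar> powr p) * ?T k x \<partial>M)) \<longlonglongrightarrow> 2 * (I (v n) * \<Lambda>)"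
        by (intro ennreal_tendsto_cmult) auto
      moreover have "F (2 * real n) (v n) = (\<lambda>k. 2 * (\<integral>\<^sup>+x. ennreal (\<bar>v n x\<bar> powr p) * ?T k x \<partial>M))"
        using F_eq by (rule ext)
      moreover have "2 * (I (v n) * \<Lambda>) = 2 * \<Lambda> * I (v n)" by (simp add: mult_ac)
      ultimately show ?thesis by simp
    qed
    define W where "W n = I (\<lambda>x. u x - v n x)" for n
    have W_eq: "I u = I (v n) + W n" for n
    proof -
      have "I u = (\<integral>\<^sup>+x. ennreal (\<bar>v n x\<bar> powr p) + ennreal (\<bar>u x - v n x\<bar> powr p) \<partial>M)"
        unfolding I_def by (intro nn_integral_cong) (auto simp: v_def)
      also have "\<dots> = I (v n) + W n" unfolding I_def W_def by (rule nn_integral_add) measurable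
      finally show ?thesis .
    qed
    have W_lim: "W \<longlonglongrightarrow> 0"
    proof -
      have "(\<lambda>n. \<integral>\<^sup>+x. ennreal (\<bar>u x - v n x\<bar> powr p) \<partial>M) \<longlonglongrightarrow> (\<integral>\<^sup>+x. 0 \<partial>M)"
      proof (rule nn_integral_dominated_convergence)
        show "AE x in M. ennreal (\<bar>u x - v n x\<bar> powr p) \<le> ennreal (\<bar>u x\<bar> powr p)" for n
          by (rule AE_I2) (simp add: v_def)
        show "(\<integral>\<^sup>+x. ennreal (\<bar>u x\<bar> powr p) \<partial>M) < \<infinity>" using I_fin by (simp add: I_def)
        show "AE x in M. (\<lambda>n. ennreal (\<bar>u x - v n x\<bar> powr p)) \<longlonglongrightarrow> 0"
        proof (rule AE_I2)
          fix x
          obtain m :: nat where "dist z x \<le> real m" using real_arch_simple by blast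
          then have "eventually (\<lambda>n. ennreal (\<bar>u x - v n x\<bar> powr p) = 0) sequentially"
            by (intro eventually_sequentiallyI[of m]) (auto simp: v_def)
          then show "(\<lambda>n. ennreal (\<bar>u x - v n x\<bar> powr p)) \<longlonglongrightarrow> 0" by (rule tendsto_eventually)
        qed
      qed measurable
      then show ?thesis by (simp add: W_def[abs_def] I_def)
    qed
    have W_fin: "W n < top" for n using W_eq[of n] I_fin by (metis add.commute ennreal_add_less_top le_iff_add order_le_less_trans)
    have "E \<longlonglongrightarrow> 2 * \<Lambda> * I u"
    proof (rule tendsto_ennreal_sandwich)
      show "2 * \<Lambda> * I u < top" using \<Lambda> I_fin by (simp add: ennreal_mult_less_top)
    next
      fix c :: real assume c: "1 < c"
      obtain d where d: "0 \<le> d" "\<And>a b. \<bar>a + b\<bar> powr p \<le> c * \<bar>a\<bar> powr p + d * \<bar>b\<bar> powr p"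
        using abs_add_powr_le[OF p c] by blast
      have lim: "(\<lambda>n. A + B * W n) \<longlonglongrightarrow> A" if "B < top" for A B
        using tendsto_add[OF tendsto_const[of A] ennreal_tendsto_cmult[OF that W_lim]] by simp
      have 1: "limsup E \<le> ennreal c * (2 * \<Lambda> * I (v n)) + ennreal d * (D * W n)" if n: "1 \<le> n" for n
      proof (rule limsup_le_limit)
        fix k
        have "F (2 * real n) (\<lambda>x. v n x + (u x - v n x)) k
            \<le> ennreal c * F (2 * real n) (v n) k + ennreal d * F (2 * real n) (\<lambda>x. u x - v n x) k"
        proof -
          have "far_energy M (\<alpha> + s k * p) p (2 * real n) (\<lambda>x. v n x + (u x - v n x))
              \<le> ennreal c * far_energy M (\<alpha> + s k * p) p (2 * real n) (v n)
                + ennreal d * far_energy M (\<alpha> + s k * p) p (2 * real n) (\<lambda>x. u x - v n x)"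
            using c by (intro far_energy_add_le[OF sf ident vm _ _ d]) auto
          from mult_left_mono[OF this, of "ennreal (s k)"] show ?thesis
            by (simp add: F_def distrib_left mult.left_commute)
        qed
        also have "F (2 * real n) (\<lambda>x. u x - v n x) k \<le> D * W n"
          unfolding W_def using n by (intro F_bound) auto
        finally have "F (2 * real n) u k \<le> ennreal c * F (2 * real n) (v n) k + ennreal d * (D * W n)"
          by (simp add: add_left_mono mult_left_mono)
        then show "E k \<le> ennreal c * F (2 * real n) (v n) k + ennreal d * (D * W n) + N (2 * real n) k"
          using E_le_F[of "2 * real n" k] n by (auto elim: order_trans intro: add_right_mono)
      next
        have "(\<lambda>k. ennreal c * F (2 * real n) (v n) k + ennreal d * (D * W n) + N (2 * real n) k)
            \<longlonglongrightarrow> ennreal c * (2 * \<Lambda> * I (v n)) + ennreal d * (D * W n) + 0"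
          by (intro tendsto_add tendsto_const ennreal_tendsto_cmult F_v n N0) simp
        then show "(\<lambda>k. ennreal c * F (2 * real n) (v n) k + ennreal d * (D * W n) + N (2 * real n) k)
            \<longlonglongrightarrow> ennreal c * (2 * \<Lambda> * I (v n)) + ennreal d * (D * W n)" by simp
      qed
      have "limsup E \<le> ennreal c * (2 * \<Lambda> * I u) + (ennreal d * D) * W n" if n: "1 \<le> n" for n
      proof -
        have "ennreal c * (2 * \<Lambda> * I (v n)) \<le> ennreal c * (2 * \<Lambda> * I u)"
          by (intro mult_left_mono Iv_le) auto
        then show ?thesis using order_trans[OF 1[OF n]] by (simp add: add_right_mono mult.assoc)
      qed
      moreover have "ennreal d * D < top" using D_fin by (simp add: ennreal_mult_less_top)
      ultimately show "limsup E \<le> ennreal c * (2 * \<Lambda> * I u)"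
        by (intro LIMSEQ_le_const[OF lim]) auto
      have 2: "2 * \<Lambda> * I (v n) \<le> ennreal c * liminf E + ennreal d * (D * W n)" if n: "1 \<le> n" for n
      proof (rule limit_le_liminf)
        fix k
        have "F (2 * real n) (\<lambda>x. u x + (v n x - u x)) k
            \<le> ennreal c * F (2 * real n) u k + ennreal d * F (2 * real n) (\<lambda>x. v n x - u x) k"
        proof -
          have "far_energy M (\<alpha> + s k * p) p (2 * real n) (\<lambda>x. u x + (v n x - u x))
              \<le> ennreal c * far_energy M (\<alpha> + s k * p) p (2 * real n) u
                + ennreal d * far_energy M (\<alpha> + s k * p) p (2 * real n) (\<lambda>x. v n x - u x)"
            using c by (intro far_energy_add_le[OF sf ident um _ _ d]) auto
          from mult_left_mono[OF this, of "ennreal (s k)"] show ?thesis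
            by (simp add: F_def distrib_left mult.left_commute)
        qed
        also have "F (2 * real n) (\<lambda>x. v n x - u x) k \<le> D * W n"
        proof -
          have "I (\<lambda>x. v n x - u x) = W n" by (simp add: W_def I_def abs_minus_commute)
          moreover have "F (2 * real n) (\<lambda>x. v n x - u x) k \<le> D * I (\<lambda>x. v n x - u x)"
            using n by (intro F_bound) auto
          ultimately show ?thesis by simp
        qed
        also have "F (2 * real n) u k \<le> E k" by (rule F_le_E)
        finally show "F (2 * real n) (v n) k \<le> ennreal c * E k + ennreal d * (D * W n)"
          by (simp add: add_mono mult_left_mono)
      next
        show "2 * \<Lambda> * I (v n) < top"
          using \<Lambda> Iv_fin[of n] by (simp add: ennreal_mult_less_top)
        show "ennreal d * (D * W n) < top" using D_fin W_fin by (simp add: ennreal_mult_less_top)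
      qed (use c F_v n in auto)
      have "2 * \<Lambda> * I u \<le> ennreal c * liminf E + (ennreal d * D + 2 * \<Lambda>) * W n" if n: "1 \<le> n" for n
      proof -
        have "2 * \<Lambda> * I u = 2 * \<Lambda> * I (v n) + 2 * \<Lambda> * W n" by (simp add: W_eq[of n] distrib_left)
        also have "\<dots> \<le> (ennreal c * liminf E + ennreal d * (D * W n)) + 2 * \<Lambda> * W n"
          by (intro add_right_mono 2 n)
        finally show ?thesis by (simp add: distrib_right add.assoc mult.assoc)
      qed
      moreover have "ennreal d * D + 2 * \<Lambda> < top" using D_fin \<Lambda> by (simp add: ennreal_mult_less_top)
      ultimately show "2 * \<Lambda> * I u \<le> ennreal c * liminf E"
        by (intro LIMSEQ_le_const[OF lim[of "ennreal d * D + 2 * \<Lambda>"]]) auto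
    qed
    then show ?thesis by (simp add: E_def[abs_def])
  qed
  note seq = this
  show ?thesis
    unfolding tendsto_at_iff_sequentially I_def[symmetric]
  proof (intro allI impI)
    fix s :: "nat \<Rightarrow> real" assume "\<forall>i. s i \<in> {0<..} - {0}" and lim: "s \<longlonglongrightarrow> 0"
    then have pos: "0 < s i" for i by auto
    obtain m where m: "\<And>i. m \<le> i \<Longrightarrow> s i < b"
      using order_tendstoD(2)[OF lim b] by (auto simp: eventually_sequentially)
    have "(\<lambda>k. energy M \<alpha> p (s (k + m)) u) \<longlonglongrightarrow> 2 * \<Lambda> * I u"
      using pos m by (intro seq LIMSEQ_ignore_initial_segment lim) auto
    then show "((\<lambda>s. energy M \<alpha> p s u) \<circ> s) \<longlonglongrightarrow> 2 * \<Lambda> * I u"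
      unfolding comp_def by (rule LIMSEQ_offset)
  qed
qed

section \<open>Hausdorff measures\<close>

lemma divide_le_iff_ennreal:
  fixes x y c :: ennreal
  assumes "0 < c" "c < top"
  shows "x / c \<le> y \<longleftrightarrow> x \<le> c * y"
proof
  assume "x / c \<le> y"
  then have "c * (x / c) \<le> c * y" by (rule mult_left_mono) simp
  also have "c * (x / c) = x" using assms by (simp add: ennreal_times_divide mult.commute[of c] ennreal_mult_divide_eq)
  finally show "x \<le> c * y" .
qed (use assms in \<open>auto intro: divide_le_posI_ennreal\<close>)

lemma hausdorff_premeasure_antimono:
  "\<delta> \<le> \<delta>' \<Longrightarrow> hausdorff_premeasure a \<delta>' A \<le> hausdorff_premeasure a \<delta> A"
  unfolding hausdorff_premeasure_def
  by (rule INF_superset_mono) (auto intro: order_trans)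

text \<open>
  Once the diameters are below the separation \<open>e\<close>, no member of a cover meets both sets, so every
  cover of the union splits into covers of the two sets.
\<close>

lemma hausdorff_outer_measure_metric:
  fixes A B :: "'a::metric_space set"
  assumes e: "0 < e" and sep: "\<And>x y. x \<in> A \<Longrightarrow> y \<in> B \<Longrightarrow> e \<le> dist x y"
  shows "hausdorff_outer_measure a A + hausdorff_outer_measure a B
         \<le> hausdorff_outer_measure a (A \<union> B)"
proof -
  have split: "hausdorff_premeasure a \<delta> A + hausdorff_premeasure a \<delta> B
      \<le> hausdorff_premeasure a \<delta> (A \<union> B)" if \<delta>: "0 < \<delta>" "\<delta> < e" for \<delta>
    unfolding hausdorff_premeasure_def[of a \<delta> "A \<union> B"]
  proof (rule INF_greatest)
    fix C :: "nat \<Rightarrow> 'a set"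
    assume "C \<in> {C. A \<union> B \<subseteq> (\<Union>i. C i) \<and> (\<forall>i. bounded (C i) \<and> diameter (C i) \<le> \<delta>)}"
    then have cov: "A \<union> B \<subseteq> (\<Union>i. C i)" and bd: "\<And>i. bounded (C i)"
      and dm: "\<And>i. diameter (C i) \<le> \<delta>" by auto
    define CA where "CA i = (if C i \<inter> A = {} then {} else C i)" for i
    define CB where "CB i = (if C i \<inter> B = {} then {} else C i)" for i
    have one: "C i \<inter> A = {} \<or> C i \<inter> B = {}" for i
    proof (rule ccontr)
      assume "\<not> ?thesis"
      then obtain x y where "x \<in> C i" "x \<in> A" "y \<in> C i" "y \<in> B" by blast
      with diameter_bounded_bound[OF bd] have "dist x y \<le> diameter (C i)" by blast
      with sep[OF \<open>x \<in> A\<close> \<open>y \<in> B\<close>] dm[of i] \<delta> show False by linarith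
    qed
    have "hausdorff_premeasure a \<delta> A \<le> (\<Sum>i. ennreal (diameter (CA i) powr a))"
      unfolding hausdorff_premeasure_def
    proof (rule INF_lower, safe)
      fix x assume "x \<in> A"
      then obtain i where "x \<in> C i" using cov by blast
      then have "x \<in> CA i" using \<open>x \<in> A\<close> by (auto simp: CA_def)
      then show "x \<in> (\<Union>i. CA i)" by blast
    qed (use bd dm \<delta> in \<open>auto simp: CA_def\<close>)
    moreover have "hausdorff_premeasure a \<delta> B \<le> (\<Sum>i. ennreal (diameter (CB i) powr a))"
      unfolding hausdorff_premeasure_def
    proof (rule INF_lower, safe)
      fix x assume "x \<in> B"
      then obtain i where "x \<in> C i" using cov by blast
      then have "x \<in> CB i" using \<open>x \<in> B\<close> by (auto simp: CB_def)
      then show "x \<in> (\<Union>i. CB i)" by blast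
    qed (use bd dm \<delta> in \<open>auto simp: CB_def\<close>)
    ultimately have "hausdorff_premeasure a \<delta> A + hausdorff_premeasure a \<delta> B \<le>
        (\<Sum>i. ennreal (diameter (CA i) powr a)) + (\<Sum>i. ennreal (diameter (CB i) powr a))"
      by (rule add_mono)
    also have "\<dots> = (\<Sum>i. ennreal (diameter (CA i) powr a) + ennreal (diameter (CB i) powr a))"
      by (rule suminf_add) auto
    also have "\<dots> \<le> (\<Sum>i. ennreal (diameter (C i) powr a))"
      using one by (intro suminf_le) (auto simp: CA_def CB_def)
    finally show "hausdorff_premeasure a \<delta> A + hausdorff_premeasure a \<delta> B \<le>
        (\<Sum>i. ennreal (diameter (C i) powr a))" .
  qed
  have "hausdorff_premeasure a \<delta> A + hausdorff_premeasure a \<delta>' B \<le> hausdorff_outer_measure a (A \<union> B)"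
    if \<delta>: "0 < \<delta>" "0 < \<delta>'" for \<delta> \<delta>'
  proof -
    define \<eta> where "\<eta> = Min {\<delta>, \<delta>', e / 2}"
    have \<eta>: "0 < \<eta>" "\<eta> < e" "\<eta> \<le> \<delta>" "\<eta> \<le> \<delta>'" using \<delta> e by (auto simp: \<eta>_def min_def)
    have "hausdorff_premeasure a \<delta> A + hausdorff_premeasure a \<delta>' B
        \<le> hausdorff_premeasure a \<eta> A + hausdorff_premeasure a \<eta> B"
      by (intro add_mono hausdorff_premeasure_antimono \<eta>)
    also have "\<dots> \<le> hausdorff_premeasure a \<eta> (A \<union> B)" by (rule split) fact+
    also have "\<dots> \<le> hausdorff_outer_measure a (A \<union> B)"
      unfolding hausdorff_outer_measure_def using \<eta> by (intro SUP_upper) auto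
    finally show ?thesis .
  qed
  then have "(SUP \<delta>\<in>{0<..}. SUP \<delta>'\<in>{0<..}. hausdorff_premeasure a \<delta> A + hausdorff_premeasure a \<delta>' B)
      \<le> hausdorff_outer_measure a (A \<union> B)"
    by (intro SUP_least) auto
  also have "(SUP \<delta>\<in>{0<..}. SUP \<delta>'\<in>{0<..}. hausdorff_premeasure a \<delta> A + hausdorff_premeasure a \<delta>' B)
     = (SUP \<delta>\<in>{0<..}. hausdorff_premeasure a \<delta> A + hausdorff_outer_measure a B)"
    unfolding hausdorff_outer_measure_def by (intro SUP_cong refl ennreal_SUP_add_right[symmetric]) (auto simp: gt_ex)
  also have "\<dots> = hausdorff_outer_measure a A + hausdorff_outer_measure a B"
    unfolding hausdorff_outer_measure_def[of a A] by (intro ennreal_SUP_add_left) (auto simp: gt_ex)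
  finally show ?thesis .
qed

lemma hausdorff_outer_measure_empty [simp]: "hausdorff_outer_measure a {} = 0"
  by (simp add: hausdorff_outer_measure_def hausdorff_premeasure_empty)

lemma hausdorff_outer_measure_mono:
  "A \<subseteq> B \<Longrightarrow> hausdorff_outer_measure a A \<le> hausdorff_outer_measure a B"
  unfolding hausdorff_outer_measure_def by (intro SUP_mono') (rule hausdorff_premeasure_mono)

lemma hausdorff_outer_measure_countably_subadditive:
  "hausdorff_outer_measure a (\<Union>i. F i) \<le> (\<Sum>i. hausdorff_outer_measure a (F i))"
  unfolding hausdorff_outer_measure_def[of a "\<Union>i. F i"]
proof (rule SUP_least)
  fix \<delta> :: real assume "\<delta> \<in> {0<..}"
  then have "(\<Sum>i. hausdorff_premeasure a \<delta> (F i)) \<le> (\<Sum>i. hausdorff_outer_measure a (F i))"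
    unfolding hausdorff_outer_measure_def by (intro suminf_le SUP_upper) auto
  then show "hausdorff_premeasure a \<delta> (\<Union>i. F i) \<le> (\<Sum>i. hausdorff_outer_measure a (F i))"
    using hausdorff_premeasure_countably_subadditive order_trans by blast
qed

lemma hausdorff_outer_measure_subadditive:
  "hausdorff_outer_measure a (A \<union> B) \<le> hausdorff_outer_measure a A + hausdorff_outer_measure a B"
proof -
  have "hausdorff_outer_measure a (A \<union> B) \<le> (\<Sum>i. hausdorff_outer_measure a (binaryset A B i))"
    using hausdorff_outer_measure_countably_subadditive[of a "binaryset A B"]
    by (simp add: UN_binaryset_eq)
  also have "\<dots> = hausdorff_outer_measure a A + hausdorff_outer_measure a B"
    by (rule suminf_binaryset_eq) simp
  finally show ?thesis .
qed

lemma suminf_ennreal_tail_tendsto_0: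
  fixes f :: "nat \<Rightarrow> ennreal"
  assumes "(\<Sum>k. f k) < top"
  shows "(\<lambda>n. \<Sum>k. f (k + n)) \<longlonglongrightarrow> 0"
proof -
  have "f k < top" for k using assms ennreal_suminf_lessD by blast
  then have f: "f k = ennreal (enn2real (f k))" for k by (metis ennreal_enn2real)
  have s: "summable (\<lambda>k. enn2real (f k))"
    by (rule summable_suminf_not_top) (use assms f in auto)
  have "(\<Sum>k. f (k + n)) = ennreal (\<Sum>k. enn2real (f (k + n)))" for n
    by (subst f, rule suminf_ennreal2) (use summable_ignore_initial_segment[OF s] in auto)
  moreover have "(\<lambda>n. ennreal (\<Sum>k. enn2real (f (k + n)))) \<longlonglongrightarrow> ennreal 0"
    by (intro tendsto_ennrealI suminf_exist_split2 s)
  ultimately show ?thesis by simp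
qed

text \<open>
  Caratheodory's criterion for metric outer measures.  The points of \<open>E\<close> off \<open>A\<close> are exhausted by the
  sets \<open>G k\<close>, which are separated from \<open>A\<close>.  The layers \<open>R k\<close> in between are separated from each other
  unless they are adjacent, so the sums over the even and over the odd layers are both bounded by
  the measure of \<open>E\<close>.  Hence the whole series converges, and its tails bound the measure that
  \<open>G k\<close> misses.
\<close>

lemma closed_in_sets_hausdorff_measure:
  fixes A :: "'a::metric_space set"
  assumes A: "closed A"
  shows "A \<in> sets (hausdorff_measure a)"
proof (cases "A = {}")
  case False
  let ?H = "hausdorff_outer_measure a"
  have "?H (E \<inter> A) + ?H (E - A) \<le> ?H E" for E
  proof (cases "?H E = top")
    case fin: False
    define r where "r k = 1 / (real k + 1)" for k
    have r: "r k > 0" "r (Suc k) < r k" for k by (auto simp: r_def field_simps)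
    have r_mono: "r j \<le> r i" if "i \<le> j" for i j using that by (simp add: r_def field_simps)
    define G where "G k = {x \<in> E. r k \<le> infdist x A}" for k
    define R where "R k = {x \<in> E. r (k + 2) \<le> infdist x A \<and> infdist x A < r (k + 1)}" for k
    have gap: "e \<le> dist x y" if "s + e \<le> infdist x A" "infdist y A \<le> s" for x y s e
      using infdist_triangle[of x A y] that by linarith
    have alternate: "(\<Sum>k<N. ?H (R (2 * k + j))) \<le> ?H (G (2 * N + j))" for N j
    proof (induction N)
      case (Suc N)
      let ?m = "2 * N + j"
      have "(\<Sum>k<Suc N. ?H (R (2 * k + j))) \<le> ?H (G ?m) + ?H (R ?m)"
        using Suc by (simp add: add_right_mono)
      also have "\<dots> \<le> ?H (G ?m \<union> R ?m)"
        by (rule hausdorff_outer_measure_metric[of "r ?m - r (Suc ?m)"], use r[of ?m] in simp,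
            rule gap[of "r (Suc ?m)"]) (auto simp: G_def R_def)
      also have "\<dots> \<le> ?H (G (2 * Suc N + j))"
        using r_mono[of ?m "?m + 2"]
        by (intro hausdorff_outer_measure_mono) (auto simp: G_def R_def add_ac)
      finally show ?case .
    qed simp
    have GE: "?H (G k) \<le> ?H E" for k by (rule hausdorff_outer_measure_mono) (auto simp: G_def)
    have "(\<Sum>k<n. ?H (R k)) \<le> 2 * ?H E" for n
    proof -
      have "(\<Sum>k<2 * n. ?H (R k)) = (\<Sum>k<n. ?H (R (2 * k + 0))) + (\<Sum>k<n. ?H (R (2 * k + 1)))"
        by (induction n) (auto simp: add_ac)
      also have "\<dots> \<le> ?H E + ?H E"
        by (intro add_mono order_trans[OF alternate] GE)
      finally have "(\<Sum>k<2 * n. ?H (R k)) \<le> 2 * ?H E" by (simp add: mult_2)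
      moreover have "(\<Sum>k<n. ?H (R k)) \<le> (\<Sum>k<2 * n. ?H (R k))" by (rule sum_mono2) auto
      ultimately show ?thesis by simp
    qed
    then have "(\<Sum>k. ?H (R k)) \<le> 2 * ?H E" by (intro suminf_le_const) auto
    also have "\<dots> < top" using fin by (simp add: ennreal_mult_less_top top.not_eq_extremum)
    finally have "(\<lambda>n. \<Sum>k. ?H (R (k + n))) \<longlonglongrightarrow> 0" by (rule suminf_ennreal_tail_tendsto_0)
    then have lim: "(\<lambda>n. ?H E + (\<Sum>k. ?H (R (k + n)))) \<longlonglongrightarrow> ?H E + 0"
      by (intro tendsto_add tendsto_const)
    have "?H (E \<inter> A) + ?H (E - A) \<le> ?H E + (\<Sum>k. ?H (R (k + n)))" for n
    proof -
      have "E - A \<subseteq> G (Suc n) \<union> (\<Union>k. R (k + n))"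
      proof
        fix x assume x: "x \<in> E - A"
        then have "infdist x A > 0"
          using A False by (simp add: in_closed_iff_infdist_zero infdist_nonneg less_le)
        moreover have "r \<longlonglongrightarrow> 0" using LIMSEQ_inverse_real_of_nat by (simp add: r_def[abs_def] inverse_eq_divide add.commute)
        ultimately have "eventually (\<lambda>k. r k < infdist x A) sequentially" by (rule order_tendstoD[rotated])
        then have ex: "\<exists>k. r k \<le> infdist x A" by (auto simp: eventually_sequentially intro: less_imp_le)
        define k where "k = (LEAST k. r k \<le> infdist x A)"
        have k: "r k \<le> infdist x A" unfolding k_def using ex by (rule LeastI_ex)
        have k': "infdist x A < r i" if "i < k" for i
          using not_less_Least[OF that[unfolded k_def]] by simp
        show "x \<in> G (Suc n) \<union> (\<Union>k. R (k + n))"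
        proof (cases "k \<le> Suc n")
          case True
          with k r_mono[OF True] x show ?thesis by (auto simp: G_def)
        next
          case False
          then obtain i where i: "k = i + n + 2" by (metis add.commute add_2_eq_Suc less_eq_Suc_le not_le le_Suc_ex add.assoc)
          with x k k'[of "i + n + 1"] have "x \<in> R (i + n)" by (auto simp: R_def)
          then show ?thesis by blast
        qed
      qed
      then have "?H (E - A) \<le> ?H (G (Suc n) \<union> (\<Union>k. R (k + n)))"
        by (rule hausdorff_outer_measure_mono)
      also have "\<dots> \<le> ?H (G (Suc n)) + ?H (\<Union>k. R (k + n))"
        by (rule hausdorff_outer_measure_subadditive)
      also have "?H (\<Union>k. R (k + n)) \<le> (\<Sum>k. ?H (R (k + n)))"
        by (rule hausdorff_outer_measure_countably_subadditive)
      finally have "?H (E - A) \<le> ?H (G (Suc n)) + (\<Sum>k. ?H (R (k + n)))"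
        by (simp add: add_left_mono)
      then have "?H (E \<inter> A) + ?H (E - A) \<le> (?H (E \<inter> A) + ?H (G (Suc n))) + (\<Sum>k. ?H (R (k + n)))"
        by (simp add: add.assoc add_left_mono)
      also have "?H (E \<inter> A) + ?H (G (Suc n)) \<le> ?H (E \<inter> A \<union> G (Suc n))"
        by (rule hausdorff_outer_measure_metric[of "r (Suc n)"], use r in simp, subst dist_commute,
           rule gap[of 0]) (auto simp: G_def)
      also have "\<dots> \<le> ?H E" by (rule hausdorff_outer_measure_mono) (auto simp: G_def)
      finally show ?thesis by (simp add: add_right_mono)
    qed
    then show ?thesis using LIMSEQ_le_const[OF lim] by auto
  qed auto
  moreover have "?H E \<le> ?H (E \<inter> A) + ?H (E - A)" for E
    using hausdorff_outer_measure_subadditive[of a "E \<inter> A" "E - A"] by (simp add: Int_Diff_Un)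
  ultimately show ?thesis
    unfolding sets_hausdorff_measure lambda_system_def
    by (auto simp: Int_commute Diff_eq intro: antisym)
qed (metis sets.empty_sets)

lemma borel_subset_sets_hausdorff_measure:
  "sets borel \<subseteq> sets (hausdorff_measure a :: 'a::metric_space measure)"
proof -
  have "sets (borel :: 'a measure) = sigma_sets UNIV (Collect closed)"
    by (simp add: borel_eq_closed)
  also have "\<dots> \<subseteq> sets (hausdorff_measure a)"
    using sets.sigma_sets_subset[of "Collect closed" "hausdorff_measure a"] closed_in_sets_hausdorff_measure
    by auto
  finally show ?thesis .
qed

lemma hausdorff_premeasure_lipschitz_image:
  fixes f :: "'a::metric_space \<Rightarrow> 'b::metric_space"
  assumes lip: "\<And>x y. dist (f x) (f y) \<le> c * dist x y" and c: "0 < c" and a: "0 < a"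
  shows "hausdorff_premeasure a (c * \<delta>) (f ` A) \<le> ennreal (c powr a) * hausdorff_premeasure a \<delta> A"
proof -
  have "hausdorff_premeasure a (c * \<delta>) (f ` A) \<le> ennreal (c powr a) * (\<Sum>i. ennreal (diameter (C i) powr a))"
    if cov: "A \<subseteq> (\<Union>i. C i)" and bd: "\<And>i. bounded (C i)" and dm: "\<And>i. diameter (C i) \<le> \<delta>" for C
  proof -
    have d: "bounded (f ` C i) \<and> diameter (f ` C i) \<le> c * diameter (C i)" for i
    proof
      have le: "dist (f x) (f y) \<le> c * diameter (C i)" if "x \<in> C i" "y \<in> C i" for x y
        using lip[of x y] diameter_bounded_bound[OF bd that] c
        by (meson mult_left_mono less_imp_le order_trans)
      then show "bounded (f ` C i)" unfolding bounded_two_points by blast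
      have "0 \<le> c * diameter (C i)" using c diameter_ge_0[OF bd] by simp
      with le show "diameter (f ` C i) \<le> c * diameter (C i)"
        unfolding diameter_def[of "f ` C i"] by (auto intro!: cSUP_least)
    qed
    have "hausdorff_premeasure a (c * \<delta>) (f ` A) \<le> (\<Sum>i. ennreal (diameter (f ` C i) powr a))"
      unfolding hausdorff_premeasure_def
    proof (rule INF_lower, safe)
      fix i
      show "diameter (f ` C i) \<le> c * \<delta>"
        using d[of i] dm[of i] c by (meson mult_left_mono less_imp_le order_trans)
    next
      fix x assume "x \<in> A"
      with cov obtain i where "x \<in> C i" by blast
      then show "f x \<in> (\<Union>i. f ` C i)" by blast
    qed (use d in auto)
    also have "\<dots> \<le> (\<Sum>i. ennreal (c powr a) * ennreal (diameter (C i) powr a))"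
    proof (intro suminf_le)
      fix i
      have "diameter (f ` C i) powr a \<le> (c * diameter (C i)) powr a"
        using d[of i] a by (intro powr_mono2) (auto intro: diameter_ge_0)
      also have "\<dots> = c powr a * diameter (C i) powr a"
        using c bd by (simp add: powr_mult diameter_ge_0)
      finally show "ennreal (diameter (f ` C i) powr a) \<le> ennreal (c powr a) * ennreal (diameter (C i) powr a)"
        by (simp add: ennreal_leI flip: ennreal_mult)
    qed auto
    finally show ?thesis by simp
  qed
  note le = this
  have "0 < ennreal (c powr a)" "ennreal (c powr a) < top" using c by auto
  note iff = divide_le_iff_ennreal[OF this]
  have "hausdorff_premeasure a (c * \<delta>) (f ` A) / ennreal (c powr a) \<le> hausdorff_premeasure a \<delta> A"
    unfolding hausdorff_premeasure_def[of a \<delta>]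
  proof (rule INF_greatest)
    fix C :: "nat \<Rightarrow> 'a set"
    assume "C \<in> {C. A \<subseteq> (\<Union>i. C i) \<and> (\<forall>i. bounded (C i) \<and> diameter (C i) \<le> \<delta>)}"
    then show "hausdorff_premeasure a (c * \<delta>) (f ` A) / ennreal (c powr a)
        \<le> (\<Sum>i. ennreal (diameter (C i) powr a))"
      unfolding iff by (intro le) auto
  qed
  then show ?thesis unfolding iff .
qed

lemma hausdorff_outer_measure_lipschitz_image:
  fixes f :: "'a::metric_space \<Rightarrow> 'b::metric_space"
  assumes "\<And>x y. dist (f x) (f y) \<le> c * dist x y" and "0 < c" and "0 < a"
  shows "hausdorff_outer_measure a (f ` A) \<le> ennreal (c powr a) * hausdorff_outer_measure a A"
  unfolding hausdorff_outer_measure_def[of a "f ` A"]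
proof (rule SUP_least)
  fix \<delta> :: real assume "\<delta> \<in> {0<..}"
  then have "hausdorff_premeasure a (\<delta> / c) A \<le> hausdorff_outer_measure a A"
    unfolding hausdorff_outer_measure_def using \<open>0 < c\<close> by (intro SUP_upper) auto
  then show "hausdorff_premeasure a \<delta> (f ` A) \<le> ennreal (c powr a) * hausdorff_outer_measure a A"
    using hausdorff_premeasure_lipschitz_image[of f c a "\<delta> / c" A] assms
    by (auto elim!: order_trans intro: mult_left_mono)
qed

section \<open>The gasket\<close>

definition hutchinson :: "(real ^ 2) set \<Rightarrow> (real ^ 2) set" where
  "hutchinson A = (\<Union>i\<in>{0..2}. sg_map i ` A)"

lemma sg_vertex_simps [simp]:
  "sg_vertex 0 = 0" "sg_vertex (Suc 0) = vector [1, 0]" "sg_vertex 2 = vector [1 / 2, sqrt 3 / 2]"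
  by (simp_all add: sg_vertex_def vec_eq_iff forall_2)

lemma dist_sg_map: "dist (sg_map i x) (sg_map i y) = (1 / 2) * dist x y"
  by (simp add: sg_map_def dist_norm flip: scaleR_diff_right)

lemma continuous_on_sg_map: "continuous_on A (sg_map i)"
  unfolding sg_map_def by (intro continuous_intros)

lemma norm_sg_vertex: "i \<in> {0..2} \<Longrightarrow> norm (sg_vertex i) \<le> 1"
proof -
  assume "i \<in> {0..2}"
  then consider "i = 0" | "i = Suc 0" | "i = 2" by fastforce
  then show ?thesis
    by cases (simp_all add: norm_eq_sqrt_inner inner_vec_def sum_2 power2_eq_square[symmetric] power_divide)
qed

lemma hutchinson_mono: "A \<subseteq> B \<Longrightarrow> hutchinson A \<subseteq> hutchinson B"
  by (auto simp: hutchinson_def)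

lemma compact_hutchinson: "compact A \<Longrightarrow> compact (hutchinson A)"
  unfolding hutchinson_def by (auto intro!: compact_UN compact_continuous_image continuous_on_sg_map)

text \<open>
  For every \<open>n\<close> the point has a preimage in \<open>A n\<close> under one of the three maps.  As the sets decrease
  and there are finitely many maps, one map serves all \<open>n\<close>.
\<close>

lemma hutchinson_INT:
  assumes dec: "\<And>n. A (Suc n) \<subseteq> A n"
  shows "hutchinson (\<Inter>n. A n) = (\<Inter>n. hutchinson (A n))"
proof (intro antisym subsetI)
  fix x assume x: "x \<in> (\<Inter>n. hutchinson (A n))"
  define y where "y i = 2 *\<^sub>R x - sg_vertex i" for i
  have y: "x = sg_map i z \<longleftrightarrow> z = y i" for i z
  proof -
    have "x = sg_map i z \<longleftrightarrow> 2 *\<^sub>R x = 2 *\<^sub>R sg_map i z" by simp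
    also have "\<dots> \<longleftrightarrow> z = y i" by (auto simp: sg_map_def y_def algebra_simps)
    finally show ?thesis .
  qed
  have "\<exists>i\<in>{0..2}. \<forall>n. y i \<in> A n"
  proof (rule ccontr)
    assume "\<not> ?thesis"
    then obtain m where m: "\<And>i. i \<in> {0..2::nat} \<Longrightarrow> y i \<notin> A (m i)" by metis
    let ?N = "Max (m ` {0..2})"
    have "x \<in> hutchinson (A ?N)" using x by blast
    then obtain i z where "i \<in> {0..2}" "z \<in> A ?N" "x = sg_map i z"
      unfolding hutchinson_def by blast
    then have i: "i \<in> {0..2}" "y i \<in> A ?N" using y by auto
    then have "m i \<le> ?N" by simp
    then have "A ?N \<subseteq> A (m i)" using dec by (rule lift_Suc_antimono_le[rotated])
    with i m show False by blast
  qed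
  then show "x \<in> hutchinson (\<Inter>n. A n)"
    unfolding hutchinson_def using y by blast
qed (auto simp: hutchinson_def)

text \<open>
  The closed unit disc is mapped into itself, so its iterated images form a decreasing sequence of
  nonempty compact sets.  Their intersection is the fixed point.
\<close>

lemma hutchinson_fixpoint_exists: "\<exists>K. K \<noteq> {} \<and> compact K \<and> K = hutchinson K"
proof -
  define A where "A n = (hutchinson ^^ n) (cball 0 1)" for n
  have A_Suc: "A (Suc n) = hutchinson (A n)" for n by (simp add: A_def)
  have "hutchinson (cball 0 1) \<subseteq> cball 0 1"
  proof
    fix x assume "x \<in> hutchinson (cball 0 1)"
    then obtain i y where i: "i \<in> {0..2}" and y: "norm y \<le> 1" and x: "x = sg_map i y"
      by (auto simp: hutchinson_def)
    have "norm (y + sg_vertex i) \<le> 2"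
      using norm_triangle_ineq[of y "sg_vertex i"] norm_sg_vertex[OF i] y by linarith
    then show "x \<in> cball 0 1" by (simp add: x sg_map_def)
  qed
  then have dec: "A (Suc n) \<subseteq> A n" for n
    by (induction n) (auto simp: A_Suc A_def dest: hutchinson_mono)
  have cpt: "compact (A n) \<and> A n \<noteq> {}" for n
    by (induction n) (auto simp: A_Suc compact_hutchinson, auto simp: A_def hutchinson_def)
  have "(\<Inter>n. A n) = hutchinson (\<Inter>n. A n)"
  proof -
    have "(\<Inter>n. A n) = (\<Inter>n. A (Suc n))"
      using dec by blast
    also have "\<dots> = hutchinson (\<Inter>n. A n)"
      using hutchinson_INT[of A, OF dec] by (simp add: A_Suc)
    finally show ?thesis .
  qed
  moreover have "(\<Inter>n. A n) \<noteq> {}"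
    using cpt lift_Suc_antimono_le[of A, OF dec] by (intro compact_nest) auto
  moreover have "compact (\<Inter>n. A n)"
    using cpt by (intro compact_Inter) auto
  ultimately show ?thesis by blast
qed

text \<open>
  The largest distance of a point of \<open>K\<close> from \<open>L\<close> is attained and is at most half of itself.
\<close>

lemma hutchinson_fixpoint_subset:
  assumes K: "compact K" "K = hutchinson K" and L: "compact L" "L = hutchinson L" "L \<noteq> {}"
  shows "K \<subseteq> L"
proof
  fix x assume x: "x \<in> K"
  have "continuous_on K (\<lambda>x. infdist x L)" by (intro continuous_intros)
  then obtain z where z: "z \<in> K" "\<And>y. y \<in> K \<Longrightarrow> infdist y L \<le> infdist z L"
    using continuous_attains_sup[OF K(1)] x by blast
  obtain i y where i: "i \<in> {0..2}" and y: "y \<in> K" and zy: "z = sg_map i y"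
    using z(1) by (subst (asm) K(2)) (auto simp: hutchinson_def)
  obtain w where w: "w \<in> L" "infdist y L = dist y w"
    using infdist_attains_inf[OF compact_imp_closed[OF L(1)] L(3)] by metis
  have "sg_map i w \<in> L" using i w by (subst L(2)) (auto simp: hutchinson_def)
  then have "infdist z L \<le> (1 / 2) * infdist y L"
    using infdist_le[of "sg_map i w" L z] by (simp add: zy dist_sg_map w)
  then have "infdist z L \<le> 0" using z(2)[OF y] infdist_nonneg[of y L] by linarith
  then have "infdist x L = 0" using z(2)[OF x] infdist_nonneg[of x L] by linarith
  then show "x \<in> L"
    using L by (simp add: in_closed_iff_infdist_zero compact_imp_closed)
qed

lemma
  shows compact_sierpinski_gasket: "compact sierpinski_gasket"
    and sierpinski_gasket_fixpoint: "sierpinski_gasket = hutchinson sierpinski_gasket"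
    and sierpinski_gasket_nonempty: "sierpinski_gasket \<noteq> {}"
proof -
  have "\<exists>!K. K \<noteq> {} \<and> compact K \<and> K = hutchinson K"
    using hutchinson_fixpoint_exists hutchinson_fixpoint_subset by (metis subset_antisym)
  from theI'[OF this] show "compact sierpinski_gasket" "sierpinski_gasket = hutchinson sierpinski_gasket"
    "sierpinski_gasket \<noteq> {}"
    unfolding sierpinski_gasket_def hutchinson_def by auto
qed

lemma sg_dim: "0 < sg_dim" "2 powr sg_dim = 3" "(1 / 2) powr sg_dim = 1 / 3"
proof -
  show "0 < sg_dim" by (simp add: sg_dim_def)
  show 2: "2 powr sg_dim = 3" by (simp add: sg_dim_def powr_def)
  have "(1 / 2) powr sg_dim = 1 / 2 powr sg_dim" by (simp add: powr_divide)
  with 2 show "(1 / 2) powr sg_dim = 1 / 3" by simp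
qed

text \<open>
  Each of the three half-size copies contributes one third, so halving the admissible diameter does
  not increase the premeasure.  At the scale of the diameter of the gasket a single set is a cover.
\<close>

lemma hausdorff_outer_measure_gasket_finite:
  "hausdorff_outer_measure sg_dim sierpinski_gasket < top"
proof -
  let ?K = sierpinski_gasket
  let ?P = "\<lambda>\<delta>. hausdorff_premeasure sg_dim \<delta> ?K"
  define D where "D = diameter ?K + 1"
  have D: "0 < D" "diameter ?K \<le> D"
    using diameter_ge_0[of ?K] compact_sierpinski_gasket by (auto simp: D_def compact_imp_bounded)
  have half: "?P (\<delta> / 2) \<le> ?P \<delta>" if "0 < \<delta>" for \<delta>
  proof -
    define F where "F i = (if i \<le> 2 then sg_map i ` ?K else {})" for i :: nat
    have "?K = (\<Union>i. F i)"
      by (subst sierpinski_gasket_fixpoint) (auto simp: hutchinson_def F_def split: if_splits)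
    then have "?P (\<delta> / 2) = hausdorff_premeasure sg_dim (\<delta> / 2) (\<Union>i. F i)" by simp
    also have "\<dots> \<le> (\<Sum>i. hausdorff_premeasure sg_dim (\<delta> / 2) (F i))"
      by (rule hausdorff_premeasure_countably_subadditive)
    also have "\<dots> = (\<Sum>i\<in>{..2}. hausdorff_premeasure sg_dim (\<delta> / 2) (F i))"
      by (rule suminf_finite) (use that in \<open>auto simp: F_def hausdorff_premeasure_empty\<close>)
    also have "\<dots> \<le> (\<Sum>i\<in>{..2::nat}. ennreal (1 / 3) * ?P \<delta>)"
    proof (rule sum_mono)
      fix i :: nat assume i: "i \<in> {..2}"
      have "hausdorff_premeasure sg_dim ((1 / 2) * \<delta>) (sg_map i ` ?K) \<le> ennreal ((1 / 2) powr sg_dim) * ?P \<delta>"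
        by (rule hausdorff_premeasure_lipschitz_image) (auto simp: dist_sg_map sg_dim)
      then show "hausdorff_premeasure sg_dim (\<delta> / 2) (F i) \<le> ennreal (1 / 3) * ?P \<delta>"
        using i by (simp only: sg_dim) (simp add: F_def)
    qed
    also have "\<dots> = ?P \<delta>"
      by (simp add: mult.assoc[symmetric] flip: ennreal_numeral ennreal_mult)
    finally show ?thesis .
  qed
  have iter: "?P (D / 2 ^ n) \<le> ?P D" for n
  proof (induction n)
    case (Suc n)
    from half[of "D / 2 ^ n"] Suc D show ?case by (auto simp: field_simps elim: order_trans)
  qed simp
  have "hausdorff_outer_measure sg_dim ?K \<le> ?P D"
    unfolding hausdorff_outer_measure_def[of sg_dim ?K]
  proof (rule SUP_least)
    fix \<delta> :: real assume "\<delta> \<in> {0<..}"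
    then obtain n where "(1 / 2) ^ n < \<delta> / D" using D real_arch_pow_inv[of "\<delta> / D" "1 / 2"] by auto
    then have "D / 2 ^ n \<le> \<delta>" using D by (simp add: field_simps)
    then show "?P \<delta> \<le> ?P D"
      using iter[of n] hausdorff_premeasure_antimono[of "D / 2 ^ n" \<delta>] order_trans by blast
  qed
  also have "?P D \<le> (\<Sum>i. ennreal (diameter (if i = (0::nat) then ?K else {}) powr sg_dim))"
    unfolding hausdorff_premeasure_def
    by (rule INF_lower) (use D compact_sierpinski_gasket in \<open>auto simp: compact_imp_bounded split: if_splits\<close>)
  also have "\<dots> = (\<Sum>i\<in>{0::nat}. ennreal (diameter (if i = (0::nat) then ?K else {}) powr sg_dim))"
    by (rule suminf_finite) auto
  also have "\<dots> < top" by simp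
  finally show ?thesis .
qed

lemma half_gasket_subset: "x \<in> sierpinski_gasket \<Longrightarrow> (1 / 2) *\<^sub>R x \<in> sierpinski_gasket"
  by (subst sierpinski_gasket_fixpoint) (force simp: hutchinson_def sg_map_def)

lemma scale_mem_unbounded_sg_iff: "2 *\<^sub>R x \<in> unbounded_sg \<longleftrightarrow> x \<in> unbounded_sg"
proof
  assume "2 *\<^sub>R x \<in> unbounded_sg"
  then obtain n y where y: "y \<in> sierpinski_gasket" and eq: "2 *\<^sub>R x = 2 ^ n *\<^sub>R y"
    by (auto simp: unbounded_sg_def)
  have "x = (1 / 2) *\<^sub>R (2 *\<^sub>R x)" by simp
  also have "\<dots> = 2 ^ n *\<^sub>R ((1 / 2) *\<^sub>R y)" unfolding eq by simp
  finally show "x \<in> unbounded_sg" using half_gasket_subset[OF y] unfolding unbounded_sg_def by blast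
next
  assume "x \<in> unbounded_sg"
  then obtain n y where "y \<in> sierpinski_gasket" "x = 2 ^ n *\<^sub>R y" by (auto simp: unbounded_sg_def)
  then have "2 *\<^sub>R x = 2 ^ Suc n *\<^sub>R y" "y \<in> sierpinski_gasket" by auto
  then show "2 *\<^sub>R x \<in> unbounded_sg" unfolding unbounded_sg_def by blast
qed

lemma borel_unbounded_sg: "unbounded_sg \<in> sets borel"
  unfolding unbounded_sg_def
  by (intro sets.countable_UN subsetI, safe)
     (auto intro!: borel_closed compact_imp_closed compact_scaling compact_sierpinski_gasket)

text \<open>
  The unit cells of the unbounded gasket are translates of the gasket by points of this lattice.  It
  also contains translations that do not occur, which is harmless for upper bounds.
\<close>

definition triangular_lattice :: "(real ^ 2) set" where
  "triangular_lattice = {of_int i *\<^sub>R sg_vertex 1 + of_int j *\<^sub>R sg_vertex 2 | i j. True}"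

lemma triangular_latticeI:
  "x = of_int i *\<^sub>R sg_vertex 1 + of_int j *\<^sub>R sg_vertex 2 \<Longrightarrow> x \<in> triangular_lattice"
  unfolding triangular_lattice_def by blast

lemma triangular_lattice_add:
  assumes "a \<in> triangular_lattice" "b \<in> triangular_lattice"
  shows "a + b \<in> triangular_lattice"
proof -
  obtain i j k l :: int where "a = of_int i *\<^sub>R sg_vertex 1 + of_int j *\<^sub>R sg_vertex 2"
    "b = of_int k *\<^sub>R sg_vertex 1 + of_int l *\<^sub>R sg_vertex 2"
    using assms unfolding triangular_lattice_def by blast
  then show ?thesis
    by (intro triangular_latticeI[of _ "i + k" "j + l"]) (simp add: scaleR_add_left)
qed

lemma triangular_lattice_scaled_vertex:
  assumes "i \<in> {0..2}"
  shows "2 ^ n *\<^sub>R sg_vertex i \<in> triangular_lattice"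
proof -
  from assms consider "i = 0" | "i = 1" | "i = 2" by fastforce
  then show ?thesis
  proof cases
    case 1 show ?thesis by (rule triangular_latticeI[of _ 0 0]) (simp add: 1)
  next
    case 2 show ?thesis by (rule triangular_latticeI[of _ "2 ^ n" 0]) (simp add: 2)
  next
    case 3 show ?thesis by (rule triangular_latticeI[of _ 0 "2 ^ n"]) (simp add: 3)
  qed
qed

lemma unbounded_sg_subset_cells:
  "unbounded_sg \<subseteq> (\<Union>a\<in>triangular_lattice. (+) a ` sierpinski_gasket)"
proof -
  let ?U = "\<Union>a\<in>triangular_lattice. (+) a ` sierpinski_gasket"
  have "2 ^ n *\<^sub>R x \<in> ?U" if "x \<in> sierpinski_gasket" for n x
    using that
  proof (induction n arbitrary: x)
    case 0
    have "0 \<in> triangular_lattice" using triangular_lattice_scaled_vertex[of 0 0] by simp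
    with 0 show ?case by force
  next
    case (Suc n)
    from Suc.prems obtain i y where i: "i \<in> {0..2}" and y: "y \<in> sierpinski_gasket" and x: "x = sg_map i y"
      by (subst (asm) sierpinski_gasket_fixpoint) (auto simp: hutchinson_def)
    from Suc.IH[OF y] obtain a z where a: "a \<in> triangular_lattice" and z: "z \<in> sierpinski_gasket"
      and eq: "2 ^ n *\<^sub>R y = a + z" by auto
    have "2 ^ Suc n *\<^sub>R x = 2 ^ n *\<^sub>R y + 2 ^ n *\<^sub>R sg_vertex i"
      by (simp add: x sg_map_def scaleR_add_right)
    also have "\<dots> = (a + 2 ^ n *\<^sub>R sg_vertex i) + z" by (simp add: eq)
    finally show ?case
      using triangular_lattice_add[OF a triangular_lattice_scaled_vertex[OF i, of n]] z by blast
  qed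
  then show ?thesis unfolding unbounded_sg_def by blast
qed

lemma card_triangular_lattice_ball:
  "\<exists>N. \<forall>x. finite {a \<in> triangular_lattice. dist x a \<le> r} \<and>
            card {a \<in> triangular_lattice. dist x a \<le> r} \<le> N"
proof -
  let ?v = "\<lambda>(i::int, j::int). of_int i *\<^sub>R sg_vertex 1 + of_int j *\<^sub>R sg_vertex 2"
  define m where "m = \<lceil>2 * \<bar>r\<bar>\<rceil> + 1"
  have m: "2 * \<bar>r\<bar> + 1 \<le> of_int m" by (simp add: m_def)
  have "finite {a \<in> triangular_lattice. dist x a \<le> r} \<and>
        card {a \<in> triangular_lattice. dist x a \<le> r} \<le> nat (2 * m + 1) * nat (2 * m + 1)" for x
  proof -
    define y where "y = x $ 2 / (sqrt 3 / 2)"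
    define J where "J = {\<lfloor>y\<rfloor> - m..\<lfloor>y\<rfloor> + m}"
    define I where "I j = {\<lfloor>x $ 1 - of_int j / 2\<rfloor> - m..\<lfloor>x $ 1 - of_int j / 2\<rfloor> + m}" for j :: int
    have sub: "{a \<in> triangular_lattice. dist x a \<le> r} \<subseteq> (\<lambda>(j, i). ?v (i, j)) ` (SIGMA j:J. I j)"
    proof
      fix a assume "a \<in> {a \<in> triangular_lattice. dist x a \<le> r}"
      then obtain i j :: int where a: "a = ?v (i, j)" and d: "dist x a \<le> r"
        unfolding triangular_lattice_def by auto
      have c: "a $ 1 = of_int i + of_int j / 2" "a $ 2 = of_int j * (sqrt 3 / 2)"
        by (simp_all add: a)
      have "\<bar>x $ 1 - a $ 1\<bar> \<le> \<bar>r\<bar>" "\<bar>x $ 2 - a $ 2\<bar> \<le> \<bar>r\<bar>"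
        using d component_le_norm_cart[of "x - a" 1] component_le_norm_cart[of "x - a" 2]
        by (auto simp: dist_norm)
      then have 1: "\<bar>(x $ 1 - of_int j / 2) - of_int i\<bar> \<le> \<bar>r\<bar>" 
        and 2: "\<bar>x $ 2 - of_int j * (sqrt 3 / 2)\<bar> \<le> \<bar>r\<bar>" by (auto simp: c algebra_simps)
      have s: "1 \<le> sqrt (3::real)" by simp
      have "x $ 2 - of_int j * (sqrt 3 / 2) = (y - of_int j) * (sqrt 3 / 2)"
        by (simp add: y_def field_simps)
      then have "\<bar>y - of_int j\<bar> * (sqrt 3 / 2) \<le> \<bar>r\<bar>" using 2 by (simp add: abs_mult)
      moreover have "\<bar>y - of_int j\<bar> * (1 / 2) \<le> \<bar>y - of_int j\<bar> * (sqrt 3 / 2)"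
        using s by (intro mult_left_mono) auto
      ultimately have "\<bar>y - of_int j\<bar> * (1 / 2) \<le> \<bar>r\<bar>" by (rule order_trans[rotated])
      then have "\<bar>y - of_int j\<bar> \<le> 2 * \<bar>r\<bar>" by simp
      then have "j \<in> J" unfolding J_def using m by (simp, linarith)
      moreover have "i \<in> I j" using 1 m unfolding I_def by (simp, linarith)
      ultimately show "a \<in> (\<lambda>(j, i). ?v (i, j)) ` (SIGMA j:J. I j)" using a by force
    qed
    have fin: "finite (SIGMA j:J. I j)" by (auto simp: J_def I_def)
    have "card (SIGMA j:J. I j) = nat (2 * m + 1) * nat (2 * m + 1)"
      by (subst card_SigmaI) (auto simp: J_def I_def algebra_simps)
    with card_mono[OF finite_imageI[OF fin] sub] card_image_le[OF fin, of "\<lambda>(j, i). ?v (i, j)"]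
    have "card {a \<in> triangular_lattice. dist x a \<le> r} \<le> nat (2 * m + 1) * nat (2 * m + 1)"
      by linarith
    with finite_subset[OF sub finite_imageI[OF fin]] show ?thesis by blast
  qed
  then show ?thesis by blast
qed

lemma sierpinski_gasket_subset_cball: "sierpinski_gasket \<subseteq> cball 0 1"
proof -
  have "continuous_on sierpinski_gasket norm" by (intro continuous_intros)
  then obtain z where z: "z \<in> sierpinski_gasket" "\<And>y. y \<in> sierpinski_gasket \<Longrightarrow> norm y \<le> norm z"
    using continuous_attains_sup[OF compact_sierpinski_gasket sierpinski_gasket_nonempty] by blast
  then obtain i y where i: "i \<in> {0..2}" and y: "y \<in> sierpinski_gasket" and zy: "z = sg_map i y"
    by (subst (asm) (1) sierpinski_gasket_fixpoint) (auto simp: hutchinson_def)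
  have "2 * norm z = norm (y + sg_vertex i)" by (simp add: zy sg_map_def)
  also have "\<dots> \<le> norm z + 1"
    using norm_triangle_ineq[of y "sg_vertex i"] norm_sg_vertex[OF i] z(2)[OF y] by linarith
  finally show ?thesis using z(2) by force
qed

text \<open>
  A bound uniform in the centre, which self-similarity about the origin alone does not give: only
  boundedly many lattice translates of the gasket meet a ball, and each has the measure of the
  gasket.
\<close>

lemma hausdorff_outer_measure_unbounded_sg_ball:
  "\<exists>C<top. \<forall>x. hausdorff_outer_measure sg_dim (unbounded_sg \<inter> cball x r) \<le> C"
proof -
  let ?H = "hausdorff_outer_measure sg_dim"
  obtain N where fin: "\<And>x. finite {a \<in> triangular_lattice. dist x a \<le> r + 1}"
    and N: "\<And>x. card {a \<in> triangular_lattice. dist x a \<le> r + 1} \<le> N"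
    using card_triangular_lattice_ball[of "r + 1"] by blast
  have sub: "?H (\<Union>a\<in>S. A a) \<le> (\<Sum>a\<in>S. ?H (A a))" if "finite S" for S and A :: "real ^ 2 \<Rightarrow> (real ^ 2) set"
    using that
  proof induction
    case (insert a S)
    have "?H (\<Union>a\<in>insert a S. A a) \<le> ?H (A a) + ?H (\<Union>a\<in>S. A a)"
      using hausdorff_outer_measure_subadditive by simp
    also have "\<dots> \<le> ?H (A a) + (\<Sum>a\<in>S. ?H (A a))" using insert by (simp add: add_left_mono)
    finally show ?case using insert by simp
  qed simp
  have "?H (unbounded_sg \<inter> cball x r) \<le> of_nat N * ?H sierpinski_gasket" for x
  proof -
    let ?S = "{a \<in> triangular_lattice. dist x a \<le> r + 1}"
    have "unbounded_sg \<inter> cball x r \<subseteq> (\<Union>a\<in>?S. (+) a ` sierpinski_gasket)"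
    proof
      fix y assume y: "y \<in> unbounded_sg \<inter> cball x r"
      then obtain a z where a: "a \<in> triangular_lattice" and z: "z \<in> sierpinski_gasket" and "y = a + z"
        using unbounded_sg_subset_cells by auto
      moreover have "dist y a \<le> 1"
        using z sierpinski_gasket_subset_cball \<open>y = a + z\<close> by (auto simp: dist_norm)
      then have "dist x a \<le> r + 1"
        using dist_triangle[of x a y] y by auto
      ultimately show "y \<in> (\<Union>a\<in>?S. (+) a ` sierpinski_gasket)" by blast
    qed
    then have "?H (unbounded_sg \<inter> cball x r) \<le> ?H (\<Union>a\<in>?S. (+) a ` sierpinski_gasket)"
      by (rule hausdorff_outer_measure_mono)
    also have "\<dots> \<le> (\<Sum>a\<in>?S. ?H ((+) a ` sierpinski_gasket))" by (rule sub[OF fin])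
    also have "\<dots> \<le> (\<Sum>a\<in>?S. ?H sierpinski_gasket)"
      using hausdorff_outer_measure_lipschitz_image[of "(+) a" 1 sg_dim sierpinski_gasket for a] sg_dim
      by (intro sum_mono) simp
    also have "\<dots> = of_nat (card ?S) * ?H sierpinski_gasket" by simp
    also have "\<dots> \<le> of_nat N * ?H sierpinski_gasket"
      using N by (intro mult_right_mono) auto
    finally show ?thesis .
  qed
  moreover have "of_nat N * ?H sierpinski_gasket < top"
    using hausdorff_outer_measure_gasket_finite by (simp add: ennreal_mult_less_top of_nat_less_top)
  ultimately show ?thesis by blast
qed

section \<open>The measure of the unbounded gasket\<close>

lemma space_sg_measure [simp]: "space sg_measure = unbounded_sg"
  by (simp add: sg_measure_def space_restrict_space)

lemma
  fixes A :: "(real ^ 2) set"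
  assumes "A \<in> sets borel"
  shows sets_sg_measure: "unbounded_sg \<inter> A \<in> sets sg_measure"
    and emeasure_sg_measure:
      "emeasure sg_measure (unbounded_sg \<inter> A) = hausdorff_outer_measure sg_dim (unbounded_sg \<inter> A)"
proof -
  have A: "A \<in> sets (hausdorff_measure sg_dim)" and X: "unbounded_sg \<in> sets (hausdorff_measure sg_dim)"
    using assms borel_unbounded_sg borel_subset_sets_hausdorff_measure by blast+
  then show "unbounded_sg \<inter> A \<in> sets sg_measure"
    by (auto simp: sg_measure_def sets_restrict_space)
  show "emeasure sg_measure (unbounded_sg \<inter> A) = hausdorff_outer_measure sg_dim (unbounded_sg \<inter> A)"
    using A X emeasure_restrict_space[of unbounded_sg "hausdorff_measure sg_dim" "unbounded_sg \<inter> A"]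
    by (simp add: sg_measure_def emeasure_hausdorff_measure sets.Int)
qed

lemma measurable_ident_sg_measure: "(\<lambda>x. x) \<in> sg_measure \<rightarrow>\<^sub>M borel"
proof (rule measurableI)
  fix A :: "(real ^ 2) set" assume "A \<in> sets borel"
  then show "(\<lambda>x. x) -` A \<inter> space sg_measure \<in> sets sg_measure"
    using sets_sg_measure[of A] by (simp add: Int_commute)
qed simp

lemma ball_volume_sg_measure:
  "ball_volume sg_measure x r = hausdorff_outer_measure sg_dim (unbounded_sg \<inter> cball x r)"
proof -
  have "{y \<in> space sg_measure. dist x y \<le> r} = unbounded_sg \<inter> cball x r" by auto
  then show ?thesis by (simp add: ball_volume_def emeasure_sg_measure)
qed

lemma ball_volume_sg_measure_bound: "\<exists>C::real. \<forall>x. ball_volume sg_measure x r \<le> ennreal C"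
proof -
  obtain C where "C < top" "\<And>x. ball_volume sg_measure x r \<le> C"
    using hausdorff_outer_measure_unbounded_sg_ball[of r] by (auto simp: ball_volume_sg_measure)
  then show ?thesis by (metis ennreal_enn2real)
qed

lemma ball_volume_sg_measure_finite: "ball_volume sg_measure x r < top"
  using ball_volume_sg_measure_bound[of r] by (metis ennreal_less_top order_le_less_trans)

lemma sigma_finite_sg_measure: "sigma_finite_measure sg_measure"
proof
  let ?A = "(\<lambda>n::nat. unbounded_sg \<inter> cball 0 (real n)) ` UNIV"
  have "\<Union>?A = unbounded_sg"
    using real_arch_simple by (auto simp: dist_norm)
  moreover have "emeasure sg_measure (unbounded_sg \<inter> cball 0 (real n)) \<noteq> \<infinity>" for n
    using ball_volume_sg_measure_finite[of 0 "real n"]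
    by (simp add: ball_volume_sg_measure emeasure_sg_measure)
  ultimately show "\<exists>A. countable A \<and> A \<subseteq> sets sg_measure \<and> \<Union>A = space sg_measure \<and>
      (\<forall>a\<in>A. emeasure sg_measure a \<noteq> \<infinity>)"
    by (intro exI[of _ ?A]) (auto simp: sets_sg_measure)
qed

lemma hausdorff_outer_measure_sg_double:
  fixes A :: "(real ^ 2) set"
  shows "hausdorff_outer_measure sg_dim ((*\<^sub>R) 2 ` A) = 3 * hausdorff_outer_measure sg_dim A"
proof (rule antisym)
  let ?H = "hausdorff_outer_measure sg_dim :: (real ^ 2) set \<Rightarrow> ennreal"
  have lip: "?H ((*\<^sub>R) c ` B) \<le> ennreal (c powr sg_dim) * ?H B" if "0 < c" for c B
    using that sg_dim by (intro hausdorff_outer_measure_lipschitz_image) (auto simp: dist_norm simp flip: scaleR_diff_right)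
  show "?H ((*\<^sub>R) 2 ` A) \<le> 3 * ?H A" using lip[of 2 A] by (simp add: sg_dim)
  have "?H A = ?H ((*\<^sub>R) (1 / 2) ` (*\<^sub>R) 2 ` A)" by (simp add: image_image)
  also have "\<dots> \<le> ennreal (1 / 3) * ?H ((*\<^sub>R) 2 ` A)" using lip[of "1 / 2"] by (simp only: sg_dim)
  finally have "3 * ?H A \<le> 3 * (ennreal (1 / 3) * ?H ((*\<^sub>R) 2 ` A))" by (intro mult_left_mono) auto
  also have "\<dots> = ?H ((*\<^sub>R) 2 ` A)" by (simp add: mult.assoc[symmetric] flip: ennreal_numeral ennreal_mult)
  finally show "3 * ?H A \<le> ?H ((*\<^sub>R) 2 ` A)" .
qed

lemma ball_volume_sg_measure_double:
  "ball_volume sg_measure (2 *\<^sub>R x) (2 * r) = 3 * ball_volume sg_measure x r"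
proof -
  have "unbounded_sg \<inter> cball (2 *\<^sub>R x) (2 * r) = (*\<^sub>R) 2 ` (unbounded_sg \<inter> cball x r)" (is "?A = ?B")
  proof (intro antisym subsetI)
    fix y assume y: "y \<in> ?A"
    have d: "dist (2 *\<^sub>R x) y = 2 * dist x ((1 / 2) *\<^sub>R y)"
    proof -
      have "dist (2 *\<^sub>R x) y = norm (2 *\<^sub>R (x - (1 / 2) *\<^sub>R y))" by (simp add: dist_norm scaleR_diff_right)
      then show ?thesis by (simp only: norm_scaleR) (simp add: dist_norm)
    qed
    have "(1 / 2) *\<^sub>R y \<in> unbounded_sg \<inter> cball x r"
      using y d scale_mem_unbounded_sg_iff[of "(1 / 2) *\<^sub>R y"] by simp
    then show "y \<in> ?B" by (force intro: image_eqI[of _ _ "(1 / 2) *\<^sub>R y"])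
  next
    fix y assume "y \<in> ?B"
    then obtain z where "y = 2 *\<^sub>R z" "z \<in> unbounded_sg" "dist x z \<le> r" by auto
    moreover have "dist (2 *\<^sub>R x) (2 *\<^sub>R z) = 2 * dist x z"
      by (simp add: dist_norm flip: scaleR_diff_right)
    ultimately show "y \<in> ?A" by (simp add: scale_mem_unbounded_sg_iff)
  qed
  then show ?thesis by (simp add: ball_volume_sg_measure hausdorff_outer_measure_sg_double)
qed

lemma ball_volume_sg_measure_growth:
  "\<exists>C::real. 0 \<le> C \<and> (\<forall>x k. ball_volume sg_measure x (2 ^ k) \<le> ennreal (C * 3 ^ k))"
proof -
  obtain C where C: "\<And>x. ball_volume sg_measure x 1 \<le> ennreal C"
    using ball_volume_sg_measure_bound by blast
  have "ball_volume sg_measure x (2 ^ k) \<le> ennreal (max C 0 * 3 ^ k)" for x k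
  proof (induction k arbitrary: x)
    case (Suc k)
    have "ball_volume sg_measure x (2 ^ Suc k) = 3 * ball_volume sg_measure ((1 / 2) *\<^sub>R x) (2 ^ k)"
      using ball_volume_sg_measure_double[of "(1 / 2) *\<^sub>R x" "2 ^ k"] by simp
    also have "\<dots> \<le> 3 * ennreal (max C 0 * 3 ^ k)" by (intro mult_left_mono Suc) simp
    also have "\<dots> = ennreal (max C 0 * 3 ^ Suc k)"
      by (simp add: ac_simps flip: ennreal_numeral ennreal_mult)
    finally show ?case .
  qed (use C in \<open>simp add: max_def ennreal_neg order_trans[OF C]\<close>)
  then show ?thesis by (intro exI[of _ "max C 0"]) auto
qed

text \<open>
  The dilation by \<open>2\<close> maps the unbounded gasket onto itself and multiplies its measure by \<open>3\<close>.
\<close>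

lemma nn_integral_sg_measure_double:
  fixes f :: "real ^ 2 \<Rightarrow> ennreal"
  assumes [measurable]: "f \<in> borel_measurable borel"
  shows "3 * (\<integral>\<^sup>+y. f (2 *\<^sub>R y) \<partial>sg_measure) = (\<integral>\<^sup>+y. f y \<partial>sg_measure)"
proof -
  note [measurable] = measurable_ident_sg_measure
  have [measurable]: "(\<lambda>y. 2 *\<^sub>R y) \<in> sg_measure \<rightarrow>\<^sub>M borel"
    using measurable_compose[OF measurable_ident_sg_measure, of "\<lambda>y. 2 *\<^sub>R y" borel] by simp
  have "distr sg_measure borel (\<lambda>y. y) = scale_measure 3 (distr sg_measure borel (\<lambda>y. 2 *\<^sub>R y))"
  proof (rule measure_eqI)
    fix A assume "A \<in> sets (distr sg_measure borel (\<lambda>y. y))"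
    then have A: "A \<in> sets borel" by simp
    let ?B = "(\<lambda>y::real ^ 2. 2 *\<^sub>R y) -` A"
    have B: "?B \<in> sets borel"
      using measurable_sets[of "\<lambda>y::real ^ 2. 2 *\<^sub>R y" borel borel A] A by simp
    have "unbounded_sg \<inter> A = (*\<^sub>R) 2 ` (unbounded_sg \<inter> ?B)"
    proof (intro antisym subsetI)
      fix y assume y: "y \<in> unbounded_sg \<inter> A"
      then have "(1 / 2) *\<^sub>R y \<in> unbounded_sg \<inter> ?B"
        using scale_mem_unbounded_sg_iff[of "(1 / 2) *\<^sub>R y"] by simp
      then show "y \<in> (*\<^sub>R) 2 ` (unbounded_sg \<inter> ?B)" by (force intro: image_eqI[of _ _ "(1 / 2) *\<^sub>R y"])
    qed (auto simp: scale_mem_unbounded_sg_iff)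
    then have "emeasure sg_measure (unbounded_sg \<inter> A) = 3 * emeasure sg_measure (unbounded_sg \<inter> ?B)"
      using emeasure_sg_measure[OF A] emeasure_sg_measure[OF B] hausdorff_outer_measure_sg_double
      by simp
    then show "emeasure (distr sg_measure borel (\<lambda>y. y)) A
        = emeasure (scale_measure 3 (distr sg_measure borel (\<lambda>y. 2 *\<^sub>R y))) A"
      using A by (simp add: emeasure_distr Int_commute[of _ unbounded_sg])
  qed simp
  then have "(\<integral>\<^sup>+y. f y \<partial>distr sg_measure borel (\<lambda>y. y))
      = (\<integral>\<^sup>+y. f y \<partial>scale_measure 3 (distr sg_measure borel (\<lambda>y. 2 *\<^sub>R y)))" by simp
  then show ?thesis by (simp add: nn_integral_distr nn_integral_scale_measure)
qed

section \<open>Tail integrals on the unbounded gasket\<close>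

lemma geometric_suminf_ennreal:
  fixes q :: real and a :: ennreal
  assumes "0 \<le> q" "q < 1"
  shows "(\<Sum>k. ennreal (q ^ k) * a) = ennreal (1 / (1 - q)) * a"
proof -
  have "(\<Sum>k. ennreal (q ^ k)) = ennreal (1 / (1 - q))"
    using assms geometric_sums[of q] by (intro suminf_ennreal_eq) auto
  then show ?thesis by simp
qed

lemma dyadic_shell_exists:
  fixes d :: real
  assumes "1 < d"
  obtains k :: nat where "2 ^ k < d" "d \<le> 2 ^ Suc k"
proof -
  obtain n0 :: nat where "d < 2 ^ n0" using real_arch_pow[of 2 d] by auto
  then have ex: "\<exists>n. d \<le> 2 ^ n" by (auto intro: less_imp_le)
  define n where "n = (LEAST n. d \<le> 2 ^ n)"
  have n: "d \<le> 2 ^ n" unfolding n_def using ex by (rule LeastI_ex)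
  have "n \<noteq> 0" using n assms by (intro notI) simp
  then obtain k where k: "n = Suc k" using not0_implies_Suc by blast
  then have "\<not> d \<le> 2 ^ k" using not_less_Least[of k "\<lambda>n. d \<le> 2 ^ n"] by (simp add: n_def)
  then show ?thesis using that[of k] n k by simp
qed

definition shell_kernel :: "real \<Rightarrow> nat \<Rightarrow> 'a::metric_space \<Rightarrow> 'a \<Rightarrow> ennreal" where
  "shell_kernel \<beta> k x y =
     (if 2 ^ k < dist x y \<and> dist x y \<le> 2 ^ Suc k then ennreal (dist x y powr - \<beta>) else 0)"

lemma far_kernel_eq_suminf_shell_kernel: "far_kernel \<beta> 1 x y = (\<Sum>k. shell_kernel \<beta> k x y)"
proof (cases "1 < dist x y")
  case True
  then obtain k where k: "2 ^ k < dist x y" "dist x y \<le> 2 ^ Suc k" by (rule dyadic_shell_exists)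
  have "shell_kernel \<beta> j x y = 0" if "j \<noteq> k" for j
  proof (rule ccontr)
    assume "shell_kernel \<beta> j x y \<noteq> 0"
    then have j: "2 ^ j < dist x y" "dist x y \<le> 2 ^ Suc j" by (auto simp: shell_kernel_def split: if_splits)
    have "(2::real) ^ j < 2 ^ Suc k" "(2::real) ^ k < 2 ^ Suc j"
      using j k by linarith+
    then have "j < Suc k" "k < Suc j" by (simp_all only: power_strict_increasing_iff one_less_numeral_iff semiring_norm)
    with that show False by simp
  qed
  then have "(\<Sum>k. shell_kernel \<beta> k x y) = (\<Sum>j\<in>{k}. shell_kernel \<beta> j x y)"
    by (intro suminf_finite) auto
  with True k show ?thesis by (simp add: far_kernel_def shell_kernel_def)
next
  case False
  have "shell_kernel \<beta> k x y = 0" for k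
  proof -
    have "(1::real) \<le> 2 ^ k" by simp
    with False have "\<not> 2 ^ k < dist x y" by linarith
    then show ?thesis by (simp add: shell_kernel_def)
  qed
  with False show ?thesis by (simp add: far_kernel_def)
qed

lemma measurable_shell_kernel [measurable]:
  fixes x :: "'a::{metric_space, second_countable_topology}"
  shows "shell_kernel \<beta> k x \<in> borel_measurable borel"
  unfolding shell_kernel_def[abs_def] by measurable

lemma tail_integral_eq_suminf:
  fixes M :: "'a::{metric_space, second_countable_topology} measure"
  assumes ident: "(\<lambda>x. x) \<in> M \<rightarrow>\<^sub>M borel"
  shows "tail_integral M \<beta> 1 x = (\<Sum>k. \<integral>\<^sup>+y. shell_kernel \<beta> k x y \<partial>M)"
  unfolding tail_integral_def far_kernel_eq_suminf_shell_kernel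
  by (intro nn_integral_suminf measurable_compose[OF ident measurable_shell_kernel])

lemma ball_volume_eq_nn_integral:
  fixes M :: "'a::{metric_space, second_countable_topology} measure"
  assumes ident: "(\<lambda>x. x) \<in> M \<rightarrow>\<^sub>M borel"
  shows "ball_volume M x r = (\<integral>\<^sup>+y. (if dist x y \<le> r then 1 else 0) \<partial>M)"
proof -
  have "(\<lambda>y. y) -` cball x r \<inter> space M \<in> sets M" by (rule measurable_sets[OF ident]) simp
  moreover have "(\<lambda>y. y) -` cball x r \<inter> space M = {y \<in> space M. dist x y \<le> r}" by auto
  ultimately have "{y \<in> space M. dist x y \<le> r} \<in> sets M" by simp
  then have "ball_volume M x r = (\<integral>\<^sup>+y. indicator {y \<in> space M. dist x y \<le> r} y \<partial>M)"
    by (simp add: ball_volume_def)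
  also have "\<dots> = (\<integral>\<^sup>+y. (if dist x y \<le> r then 1 else 0) \<partial>M)"
    by (intro nn_integral_cong) (simp add: indicator_def)
  finally show ?thesis .
qed

text \<open>
  Far away, the distances to \<open>x\<close> and to \<open>x'\<close> differ by a factor close to \<open>1\<close>.  The part within the
  radius \<open>\<rho>\<close> has finite measure and a bounded kernel.  It is essential that \<open>B\<close> is chosen before
  \<open>\<beta>\<close>: multiplied by \<open>s\<close>, it disappears in the limit.
\<close>

lemma tail_integral_compare:
  fixes M :: "'a::{metric_space, second_countable_topology} measure"
  assumes ident: "(\<lambda>x. x) \<in> M \<rightarrow>\<^sub>M borel" and fin: "\<And>r. ball_volume M x r < top"
    and R: "0 < R" and R': "0 \<le> R'" and b: "0 < b" and c: "1 < c"
  shows "\<exists>B<top. \<forall>\<beta>. 0 \<le> \<beta> \<and> \<beta> \<le> b \<longrightarrow> tail_integral M \<beta> R x \<le> ennreal c * tail_integral M \<beta> R' x' + B"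
proof -
  define \<gamma> where "\<gamma> = c powr (1 / b)"
  have \<gamma>: "1 < \<gamma>" using b c by (simp add: \<gamma>_def gr_one_powr)
  have \<gamma>b: "\<gamma> powr b = c" using b c by (simp add: \<gamma>_def powr_powr)
  \<comment> \<open>Beyond \<open>\<rho>\<close>, the distance to \<open>x'\<close> is at most \<open>\<gamma>\<close> times that to \<open>x\<close> and exceeds \<open>R'\<close>.\<close>
  define \<rho> where "\<rho> = max (dist x x' / (\<gamma> - 1)) (R' + dist x x')"
  define m where "m = max 1 (R powr - b)"
  have "tail_integral M \<beta> R x \<le> ennreal c * tail_integral M \<beta> R' x' + ennreal m * ball_volume M x \<rho>"
    if \<beta>: "0 \<le> \<beta>" "\<beta> \<le> b" for \<beta>
  proof -
    have "far_kernel \<beta> R x y \<le> ennreal c * far_kernel \<beta> R' x' y + ennreal m * (if dist x y \<le> \<rho> then 1 else 0)" for y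
    proof (cases "dist x y \<le> \<rho>")
      case True
      show ?thesis
      proof (cases "R < dist x y")
        case RT: True
        have "dist x y powr - \<beta> \<le> R powr - \<beta>" using RT R \<beta> by (intro powr_mono2') auto
        also have "R powr - \<beta> \<le> m"
        proof (cases "1 \<le> R")
          case True
          then have "R powr - \<beta> \<le> R powr 0" using \<beta> by (intro powr_mono) auto
          then show ?thesis using R by (simp add: m_def)
        next
          case False
          then have "R powr - \<beta> \<le> R powr - b" using \<beta> R by (intro powr_mono') auto
          then show ?thesis by (simp add: m_def)
        qed
        finally show ?thesis using True RT by (simp add: far_kernel_def ennreal_leI add_increasing)
      qed (simp add: far_kernel_def)
    next
      case False
      then have far: "dist x x' / (\<gamma> - 1) < dist x y" "R' + dist x x' < dist x y" by (auto simp: \<rho>_def)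
      then have 1: "R' < dist x' y" using dist_triangle[of x y x'] by (simp add: dist_commute)
      have "dist x x' < dist x y * (\<gamma> - 1)" using far \<gamma> by (simp add: pos_divide_less_eq)
      then have 2: "dist x' y \<le> \<gamma> * dist x y"
        using dist_triangle[of x' y x] by (simp add: dist_commute algebra_simps)
      have pos: "0 < dist x y" using far(1) \<gamma>
        by (metis diff_gt_0_iff_gt divide_nonneg_pos order_le_less_trans zero_le_dist)
      have "dist x y powr - \<beta> \<le> c * dist x' y powr - \<beta>"
      proof -
        have pos': "0 < dist x' y" using 1 R' by linarith
        have "dist x y powr - \<beta> = \<gamma> powr \<beta> * (\<gamma> * dist x y) powr - \<beta>"
          using \<gamma> pos by (simp add: powr_mult powr_minus field_simps)
        also have "\<dots> \<le> c * dist x' y powr - \<beta>"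
        proof (intro mult_mono)
          show "\<gamma> powr \<beta> \<le> c" unfolding \<gamma>b[symmetric] using \<gamma> \<beta> by (intro powr_mono) auto
          show "(\<gamma> * dist x y) powr - \<beta> \<le> dist x' y powr - \<beta>"
            using 2 pos' \<beta> by (intro powr_mono2') auto
        qed (use c in auto)
        finally show ?thesis .
      qed
      then have "ennreal (dist x y powr - \<beta>) \<le> ennreal c * ennreal (dist x' y powr - \<beta>)"
        using c by (simp add: ennreal_leI flip: ennreal_mult)
      then show ?thesis using 1 False by (simp add: far_kernel_def)
    qed
    then have "tail_integral M \<beta> R x \<le>
        (\<integral>\<^sup>+y. ennreal c * far_kernel \<beta> R' x' y + ennreal m * (if dist x y \<le> \<rho> then 1 else 0) \<partial>M)"
      unfolding tail_integral_def by (intro nn_integral_mono)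
    also have "\<dots> = ennreal c * tail_integral M \<beta> R' x' + ennreal m * ball_volume M x \<rho>"
    proof -
      have [measurable]: "(\<lambda>y. dist w y) \<in> borel_measurable M" for w
        using measurable_compose[OF ident, of "dist w" borel] by simp
      have [measurable]: "far_kernel \<beta> R' x' \<in> borel_measurable M"
        unfolding far_kernel_def[abs_def] by measurable
      show ?thesis unfolding ball_volume_eq_nn_integral[OF ident] tail_integral_def
        by (subst nn_integral_add) (simp_all add: nn_integral_cmult)
    qed
    finally show ?thesis .
  qed
  moreover have "ennreal m * ball_volume M x \<rho> < top" using fin by (simp add: ennreal_mult_less_top)
  ultimately show ?thesis by blast
qed

lemma shell_integral_le:
  obtains C :: real where "0 \<le> C"
    "\<And>x k \<sigma>. 0 \<le> \<sigma> \<Longrightarrow> (\<integral>\<^sup>+y. shell_kernel (sg_dim + \<sigma>) k x y \<partial>sg_measure) \<le> ennreal ((2 powr - \<sigma>) ^ k) * ennreal C"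
proof -
  obtain C where C: "0 \<le> C" "\<And>x k. ball_volume sg_measure x (2 ^ k) \<le> ennreal (C * 3 ^ k)"
    using ball_volume_sg_measure_growth by blast
  have "(\<integral>\<^sup>+y. shell_kernel (sg_dim + \<sigma>) k x y \<partial>sg_measure) \<le> ennreal ((2 powr - \<sigma>) ^ k) * ennreal (3 * C)"
    if \<sigma>: "0 \<le> \<sigma>" for x k \<sigma>
  proof -
    have pow: "(2 ^ k) powr - (sg_dim + \<sigma>) = (2 powr - \<sigma>) ^ k / 3 ^ k"
    proof -
      have "(2 ^ k) powr - (sg_dim + \<sigma>) = (2 powr - (sg_dim + \<sigma>)) ^ k"
        by (simp add: powr_realpow[symmetric] powr_powr mult.commute)
      also have "2 powr - (sg_dim + \<sigma>) = 2 powr - \<sigma> / 3"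
        using sg_dim(2) by (simp add: powr_minus_divide powr_add powr_diff)
      finally show ?thesis by (simp add: power_divide)
    qed
    have "shell_kernel (sg_dim + \<sigma>) k x y
        \<le> ennreal ((2 powr - \<sigma>) ^ k / 3 ^ k) * (if dist x y \<le> 2 ^ Suc k then 1 else 0)" for y
    proof (cases "2 ^ k < dist x y \<and> dist x y \<le> 2 ^ Suc k")
      case True
      have "dist x y powr - (sg_dim + \<sigma>) \<le> (2 ^ k) powr - (sg_dim + \<sigma>)"
        using True \<sigma> sg_dim(1) by (intro powr_mono2') auto
      then show ?thesis using True by (simp add: shell_kernel_def pow[symmetric] ennreal_leI)
    qed (auto simp: shell_kernel_def)
    then have "(\<integral>\<^sup>+y. shell_kernel (sg_dim + \<sigma>) k x y \<partial>sg_measure)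
        \<le> (\<integral>\<^sup>+y. ennreal ((2 powr - \<sigma>) ^ k / 3 ^ k) * (if dist x y \<le> 2 ^ Suc k then 1 else 0) \<partial>sg_measure)"
      by (intro nn_integral_mono)
    also have "\<dots> = ennreal ((2 powr - \<sigma>) ^ k / 3 ^ k) * ball_volume sg_measure x (2 ^ Suc k)"
    proof -
      have [measurable]: "(\<lambda>y. dist x y) \<in> borel_measurable sg_measure"
        using measurable_compose[OF measurable_ident_sg_measure, of "dist x" borel] by simp
      show ?thesis unfolding ball_volume_eq_nn_integral[OF measurable_ident_sg_measure]
        by (rule nn_integral_cmult) measurable
    qed
    also have "\<dots> \<le> ennreal ((2 powr - \<sigma>) ^ k / 3 ^ k) * ennreal (C * 3 ^ Suc k)"
      by (intro mult_left_mono C) simp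
    also have "\<dots> = ennreal ((2 powr - \<sigma>) ^ k) * ennreal (3 * C)"
      using C(1) by (simp add: field_simps flip: ennreal_mult)
    finally show ?thesis .
  qed
  then show ?thesis using that[of "3 * C"] C(1) by simp
qed

text \<open>
  The dilation by \<open>2\<close> takes one shell to the next.  It multiplies the measure by \<open>3\<close> and the kernel
  by \<open>2 powr - (sg_dim + \<sigma>) = 2 powr - \<sigma> / 3\<close>.
\<close>

lemma shell_integral_origin:
  "(\<integral>\<^sup>+y. shell_kernel (sg_dim + \<sigma>) k 0 y \<partial>sg_measure)
   = ennreal ((2 powr - \<sigma>) ^ k) * (\<integral>\<^sup>+y. shell_kernel (sg_dim + \<sigma>) 0 0 y \<partial>sg_measure)"
proof (induction k)
  case (Suc k)
  have eq: "shell_kernel (sg_dim + \<sigma>) (Suc k) 0 (2 *\<^sub>R y)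
      = ennreal (2 powr - \<sigma> / 3) * shell_kernel (sg_dim + \<sigma>) k 0 y" for y :: "real ^ 2"
  proof -
    have "(2 * norm y) powr - (sg_dim + \<sigma>) = (2 powr - (sg_dim + \<sigma>)) * norm y powr - (sg_dim + \<sigma>)"
      by (simp add: powr_mult)
    also have "2 powr - (sg_dim + \<sigma>) = 2 powr - \<sigma> / 3"
      using sg_dim(2) by (simp add: powr_minus_divide powr_add powr_diff)
    finally have "ennreal ((2 * norm y) powr - (sg_dim + \<sigma>))
        = ennreal (2 powr - \<sigma> / 3) * ennreal (norm y powr - (sg_dim + \<sigma>))"
      by (simp only:) (rule ennreal_mult, simp_all)
    then show ?thesis by (simp add: shell_kernel_def del: minus_add_distrib)
  qed
  have [measurable]: "shell_kernel (sg_dim + \<sigma>) k 0 \<in> borel_measurable sg_measure"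
    by (rule measurable_compose[OF measurable_ident_sg_measure measurable_shell_kernel])
  have "(\<integral>\<^sup>+y. shell_kernel (sg_dim + \<sigma>) (Suc k) 0 y \<partial>sg_measure)
      = 3 * (\<integral>\<^sup>+y. ennreal (2 powr - \<sigma> / 3) * shell_kernel (sg_dim + \<sigma>) k 0 y \<partial>sg_measure)"
    unfolding eq[symmetric] by (rule nn_integral_sg_measure_double[symmetric]) measurable
  also have "\<dots> = 3 * (ennreal (2 powr - \<sigma> / 3) * (\<integral>\<^sup>+y. shell_kernel (sg_dim + \<sigma>) k 0 y \<partial>sg_measure))"
    by (subst nn_integral_cmult) simp_all
  also have "\<dots> = ennreal ((2 powr - \<sigma>) ^ Suc k) * (\<integral>\<^sup>+y. shell_kernel (sg_dim + \<sigma>) 0 0 y \<partial>sg_measure)"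
    by (simp add: Suc mult.assoc[symmetric] flip: ennreal_numeral ennreal_mult)
  finally show ?case .
qed simp

definition sg_shell_integral :: ennreal where
  "sg_shell_integral = (\<integral>\<^sup>+y. shell_kernel sg_dim 0 0 y \<partial>sg_measure)"

lemma sg_shell_integral_finite: "sg_shell_integral < top"
proof -
  obtain C where C: "0 \<le> C" "\<And>x k \<sigma>. 0 \<le> \<sigma> \<Longrightarrow>
      (\<integral>\<^sup>+y. shell_kernel (sg_dim + \<sigma>) k x y \<partial>sg_measure) \<le> ennreal ((2 powr - \<sigma>) ^ k) * ennreal C"
    by (rule shell_integral_le) blast
  have "sg_shell_integral \<le> ennreal ((2 powr - 0) ^ 0) * ennreal C"
    using C(2)[of 0 0 0] by (simp only: sg_shell_integral_def add_0_right order_refl)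
  also have "\<dots> < top" by (simp add: ennreal_mult_less_top)
  finally show ?thesis .
qed

text \<open>
  The factor \<open>s\<close> of the energy times the sum of the geometric series over the dyadic shells.
\<close>

lemma geometric_weight_tendsto:
  fixes p :: real
  assumes p: "0 < p"
  shows "((\<lambda>s. s / (1 - 2 powr - (s * p))) \<longlongrightarrow> 1 / (p * ln 2)) (at_right 0)"
proof -
  have "((\<lambda>s. 1 - 2 powr - (s * p)) has_real_derivative p * ln 2) (at 0)"
    by (auto intro!: derivative_eq_intros)
  then have "((\<lambda>s. (1 - 2 powr - (s * p)) / s) \<longlongrightarrow> p * ln 2) (at 0)"
    by (simp add: has_field_derivative_iff)
  then have "((\<lambda>s. (1 - 2 powr - (s * p)) / s) \<longlongrightarrow> p * ln 2) (at_right 0)"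
    by (simp only: filterlim_at_split)
  then have "((\<lambda>s. inverse ((1 - 2 powr - (s * p)) / s)) \<longlongrightarrow> inverse (p * ln 2)) (at_right 0)"
    by (rule tendsto_inverse) (use p in simp)
  then show ?thesis by (simp add: inverse_eq_divide)
qed

lemma sg_tail_origin_tendsto:
  assumes p: "0 < p"
  shows "((\<lambda>s. ennreal s * tail_integral sg_measure (sg_dim + s * p) 1 0)
           \<longlongrightarrow> ennreal (1 / (p * ln 2)) * sg_shell_integral) (at_right 0)"
proof -
  let ?S = "\<lambda>\<sigma>. \<integral>\<^sup>+y. shell_kernel (sg_dim + \<sigma>) 0 0 y \<partial>sg_measure"
  have tail: "ennreal s * tail_integral sg_measure (sg_dim + s * p) 1 0 = ennreal (s / (1 - 2 powr - (s * p))) * ?S (s * p)"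
    if s: "0 < s" for s
  proof -
    have q: "2 powr - (s * p) < 1" using s p by (simp add: powr_less_one)
    have "tail_integral sg_measure (sg_dim + s * p) 1 0
        = (\<Sum>k. ennreal ((2 powr - (s * p)) ^ k) * ?S (s * p))"
      unfolding tail_integral_eq_suminf[OF measurable_ident_sg_measure]
      by (intro suminf_cong shell_integral_origin)
    also have "\<dots> = ennreal (1 / (1 - 2 powr - (s * p))) * ?S (s * p)"
      by (rule geometric_suminf_ennreal[OF _ q]) simp
    finally show ?thesis using s q by (simp add: mult.assoc[symmetric] flip: ennreal_mult)
  qed
  have S_le: "?S \<sigma> \<le> sg_shell_integral" if "0 \<le> \<sigma>" for \<sigma>
    unfolding sg_shell_integral_def using that
    by (intro nn_integral_mono) (auto simp: shell_kernel_def intro!: ennreal_leI powr_mono)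
  have S_ge: "ennreal (2 powr - \<sigma>) * sg_shell_integral \<le> ?S \<sigma>" if \<sigma>: "0 \<le> \<sigma>" for \<sigma>
  proof -
    have "ennreal (2 powr - \<sigma>) * shell_kernel sg_dim 0 0 y \<le> shell_kernel (sg_dim + \<sigma>) 0 0 y" for y :: "real ^ 2"
    proof (cases "1 < norm y \<and> norm y \<le> 2")
      case True
      have "2 powr - \<sigma> \<le> norm y powr - \<sigma>" using True \<sigma> by (intro powr_mono2') auto
      then have "2 powr - \<sigma> * norm y powr - sg_dim \<le> norm y powr - \<sigma> * norm y powr - sg_dim"
        by (intro mult_right_mono) auto
      also have "\<dots> = norm y powr (- \<sigma> + - sg_dim)" by (simp only: powr_add)
      also have "- \<sigma> + - sg_dim = - (sg_dim + \<sigma>)" by simp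
      finally show ?thesis using True by (simp add: shell_kernel_def ennreal_leI flip: ennreal_mult)
    qed (auto simp: shell_kernel_def)
    then have "(\<integral>\<^sup>+y. ennreal (2 powr - \<sigma>) * shell_kernel sg_dim 0 0 y \<partial>sg_measure) \<le> ?S \<sigma>"
      by (intro nn_integral_mono)
    moreover have "(\<integral>\<^sup>+y. ennreal (2 powr - \<sigma>) * shell_kernel sg_dim 0 0 y \<partial>sg_measure)
        = ennreal (2 powr - \<sigma>) * sg_shell_integral"
      unfolding sg_shell_integral_def
      by (rule nn_integral_cmult, rule measurable_compose[OF measurable_ident_sg_measure measurable_shell_kernel])
    ultimately show ?thesis by simp
  qed
  have lim: "((\<lambda>s. ennreal (f s) * sg_shell_integral) \<longlongrightarrow> ennreal (1 / (p * ln 2)) * sg_shell_integral) (at_right 0)"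
    if "(f \<longlongrightarrow> 1 / (p * ln 2)) (at_right 0)" for f
    using ennreal_tendsto_cmult[OF sg_shell_integral_finite tendsto_ennrealI[OF that]] by (simp add: mult.commute)
  have q: "2 powr - (s * p) < 1" if "0 < s" for s using that p by (simp add: powr_less_one)
  have pos: "eventually (\<lambda>s::real. 0 < s) (at_right 0)" by (rule eventually_at_right_less)
  have weight1: "((\<lambda>s. 2 powr - (s * p)) \<longlongrightarrow> 1) (at_right 0)"
  proof -
    have "((\<lambda>s. 2 powr - (s * p)) \<longlongrightarrow> 2 powr - (0 * p)) (at_right 0)"
      by (intro tendsto_intros) simp
    then show ?thesis by simp
  qed
  show ?thesis
  proof (rule tendsto_sandwich)
    show "((\<lambda>s. ennreal (s / (1 - 2 powr - (s * p)) * 2 powr - (s * p)) * sg_shell_integral)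
        \<longlongrightarrow> ennreal (1 / (p * ln 2)) * sg_shell_integral) (at_right 0)"
      using tendsto_mult[OF geometric_weight_tendsto[OF p] weight1] by (intro lim) simp
    show "((\<lambda>s. ennreal (s / (1 - 2 powr - (s * p))) * sg_shell_integral)
        \<longlongrightarrow> ennreal (1 / (p * ln 2)) * sg_shell_integral) (at_right 0)"
      by (intro lim geometric_weight_tendsto p)
    show "eventually (\<lambda>s. ennreal (s / (1 - 2 powr - (s * p)) * 2 powr - (s * p)) * sg_shell_integral
        \<le> ennreal s * tail_integral sg_measure (sg_dim + s * p) 1 0) (at_right 0)"
      using pos
    proof eventually_elim
      case (elim s)
      have "ennreal (s / (1 - 2 powr - (s * p))) * (ennreal (2 powr - (s * p)) * sg_shell_integral)
          \<le> ennreal (s / (1 - 2 powr - (s * p))) * ?S (s * p)"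
        using elim p by (intro mult_left_mono S_ge) auto
      moreover have "ennreal (s / (1 - 2 powr - (s * p)) * 2 powr - (s * p))
          = ennreal (s / (1 - 2 powr - (s * p))) * ennreal (2 powr - (s * p))"
        using elim q[OF elim] by (intro ennreal_mult) auto
      ultimately show ?case by (simp only: tail[OF elim] mult.assoc)
    qed
    show "eventually (\<lambda>s. ennreal s * tail_integral sg_measure (sg_dim + s * p) 1 0
        \<le> ennreal (s / (1 - 2 powr - (s * p))) * sg_shell_integral) (at_right 0)"
      using pos
    proof eventually_elim
      case (elim s)
      show ?case unfolding tail[OF elim] using elim p by (intro mult_left_mono S_le) auto
    qed
  qed
qed

lemma sg_tail_bound:
  assumes p: "0 < p"
  shows "\<exists>C. eventually (\<lambda>s. \<forall>x. ennreal s * tail_integral sg_measure (sg_dim + s * p) 1 x \<le> ennreal C) (at_right 0)"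
proof -
  obtain C where C: "0 \<le> C" "\<And>x k \<sigma>. 0 \<le> \<sigma> \<Longrightarrow>
      (\<integral>\<^sup>+y. shell_kernel (sg_dim + \<sigma>) k x y \<partial>sg_measure) \<le> ennreal ((2 powr - \<sigma>) ^ k) * ennreal C"
    by (rule shell_integral_le) blast
  have "((\<lambda>s. s / (1 - 2 powr - (s * p)) * C) \<longlongrightarrow> 1 / (p * ln 2) * C) (at_right 0)"
    by (intro tendsto_mult_right geometric_weight_tendsto p)
  then have "eventually (\<lambda>s. s / (1 - 2 powr - (s * p)) * C < 1 / (p * ln 2) * C + 1) (at_right 0)"
    by (rule order_tendstoD) simp
  moreover have "eventually (\<lambda>s::real. 0 < s) (at_right 0)" by (rule eventually_at_right_less)
  ultimately have "eventually (\<lambda>s. \<forall>x. ennreal s * tail_integral sg_measure (sg_dim + s * p) 1 x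
      \<le> ennreal (1 / (p * ln 2) * C + 1)) (at_right 0)"
  proof eventually_elim
    case (elim s)
    have q: "2 powr - (s * p) < 1" using elim p by (simp add: powr_less_one)
    show ?case
    proof
      fix x
      have "tail_integral sg_measure (sg_dim + s * p) 1 x \<le> (\<Sum>k. ennreal ((2 powr - (s * p)) ^ k) * ennreal C)"
        unfolding tail_integral_eq_suminf[OF measurable_ident_sg_measure]
        using elim p by (intro suminf_le C) auto
      also have "\<dots> = ennreal (1 / (1 - 2 powr - (s * p))) * ennreal C"
        by (rule geometric_suminf_ennreal[OF _ q]) simp
      also have "\<dots> = ennreal (1 / (1 - 2 powr - (s * p)) * C)"
        using q C by (intro ennreal_mult[symmetric]) auto
      finally have "ennreal s * tail_integral sg_measure (sg_dim + s * p) 1 x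
          \<le> ennreal s * ennreal (1 / (1 - 2 powr - (s * p)) * C)" by (rule mult_left_mono) simp
      also have "\<dots> = ennreal (s / (1 - 2 powr - (s * p)) * C)"
        using elim q C by (simp flip: ennreal_mult)
      also have "\<dots> \<le> ennreal (1 / (p * ln 2) * C + 1)" using elim by (intro ennreal_leI) simp
      finally show "ennreal s * tail_integral sg_measure (sg_dim + s * p) 1 x \<le> ennreal (1 / (p * ln 2) * C + 1)" .
    qed
  qed
  then show ?thesis by blast
qed

lemma sg_tail_tendsto:
  assumes p: "0 < p" and R: "0 < R"
  shows "((\<lambda>s. ennreal s * tail_integral sg_measure (sg_dim + s * p) R x)
           \<longlongrightarrow> ennreal (1 / (p * ln 2)) * sg_shell_integral) (at_right 0)"
proof -
  let ?\<Lambda> = "ennreal (1 / (p * ln 2)) * sg_shell_integral"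
  let ?T = "\<lambda>s R x. ennreal s * tail_integral sg_measure (sg_dim + s * p) R x"
  have fin: "?\<Lambda> < top" using sg_shell_integral_finite by (simp add: ennreal_mult_less_top)
  have cmp: "\<exists>B<top. \<forall>s. 0 < s \<and> s < 1 \<longrightarrow> ?T s R x \<le> ennreal c * ?T s R' x' + ennreal s * B"
    if pre: "0 < R" "0 \<le> R'" "1 < c" for R R' c and x x' :: "real ^ 2"
  proof -
    have b: "0 < sg_dim + p" using p sg_dim(1) by simp
    obtain B where B: "B < top" "\<And>\<beta>. 0 \<le> \<beta> \<Longrightarrow> \<beta> \<le> sg_dim + p \<Longrightarrow>
        tail_integral sg_measure \<beta> R x \<le> ennreal c * tail_integral sg_measure \<beta> R' x' + B"
      using tail_integral_compare[OF measurable_ident_sg_measure ball_volume_sg_measure_finite pre(1,2) b pre(3), of x x']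
      by blast
    have "?T s R x \<le> ennreal c * ?T s R' x' + ennreal s * B" if s: "0 < s" "s < 1" for s
    proof -
      have "s * p \<le> 1 * p" using s p by (intro mult_right_mono) auto
      then have "tail_integral sg_measure (sg_dim + s * p) R x
          \<le> ennreal c * tail_integral sg_measure (sg_dim + s * p) R' x' + B"
        using s p sg_dim(1) by (intro B) auto
      then have "?T s R x \<le> ennreal s * (ennreal c * tail_integral sg_measure (sg_dim + s * p) R' x' + B)"
        by (rule mult_left_mono) simp
      then show ?thesis by (simp add: distrib_left mult.left_commute)
    qed
    with B(1) show ?thesis by blast
  qed
  have seq: "(\<lambda>k. ?T (s k) R x) \<longlonglongrightarrow> ?\<Lambda>"
    if s: "\<And>k. 0 < s k" "\<And>k. s k < 1" "s \<longlonglongrightarrow> 0" for s :: "nat \<Rightarrow> real"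
  proof -
    have sr: "filterlim s (at_right 0) sequentially"
      using s s(1)[THEN less_imp_neq] by (auto simp: filterlim_at)
    have origin: "(\<lambda>k. ?T (s k) 1 0) \<longlonglongrightarrow> ?\<Lambda>"
      by (rule filterlim_compose[OF sg_tail_origin_tendsto[OF p] sr])
    have sB: "(\<lambda>k. ennreal (s k) * B) \<longlonglongrightarrow> 0" if "B < top" for B
      using ennreal_tendsto_cmult[OF that tendsto_ennrealI[OF s(3)]] by (simp add: mult.commute)
    show ?thesis
    proof (rule tendsto_ennreal_sandwich[OF fin])
      fix c :: real assume c: "1 < c"
      obtain B where B: "B < top" "\<And>s. 0 < s \<Longrightarrow> s < 1 \<Longrightarrow> ?T s R x \<le> ennreal c * ?T s 1 0 + ennreal s * B"
        using cmp[OF R _ c, of 1] by (metis zero_le_one)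
      have "(\<lambda>k. ennreal c * ?T (s k) 1 0 + ennreal (s k) * B) \<longlonglongrightarrow> ennreal c * ?\<Lambda> + 0"
        by (intro tendsto_add ennreal_tendsto_cmult origin sB B) simp
      then show "limsup (\<lambda>k. ?T (s k) R x) \<le> ennreal c * ?\<Lambda>"
        by (intro limsup_le_limit[OF B(2)[OF s(1,2)]]) simp
      obtain B' where B': "B' < top" "\<And>s. 0 < s \<Longrightarrow> s < 1 \<Longrightarrow> ?T s 1 0 \<le> ennreal c * ?T s R x + ennreal s * B'"
        using cmp[OF _ _ c, of 1 R] R by (metis zero_less_one less_imp_le)
      have "?\<Lambda> \<le> ennreal c * liminf (\<lambda>k. ?T (s k) R x) + 0"
        using c by (intro limit_le_liminf[OF _ B'(2)[OF s(1,2)] origin sB[OF B'(1)] fin]) auto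
      then show "?\<Lambda> \<le> ennreal c * liminf (\<lambda>k. ?T (s k) R x)" by simp
    qed
  qed
  show ?thesis
    unfolding tendsto_at_iff_sequentially
  proof (intro allI impI)
    fix s :: "nat \<Rightarrow> real" assume "\<forall>i. s i \<in> {0<..} - {0}" and lim: "s \<longlonglongrightarrow> 0"
    then have pos: "0 < s i" for i by auto
    obtain m where m: "\<And>i. m \<le> i \<Longrightarrow> s i < 1"
      using order_tendstoD(2)[OF lim, of 1] by (auto simp: eventually_sequentially)
    have "(\<lambda>k. ?T (s (k + m)) R x) \<longlonglongrightarrow> ?\<Lambda>"
      using pos m by (intro seq LIMSEQ_ignore_initial_segment lim) auto
    then show "((\<lambda>s. ?T s R x) \<circ> s) \<longlonglongrightarrow> ?\<Lambda>"
      unfolding comp_def by (rule LIMSEQ_offset)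
  qed
qed

section \<open>Logarithmic averages\<close>

lemma measurable_ball_volume_sg [measurable]: "ball_volume sg_measure x \<in> borel_measurable borel"
proof -
  interpret sigma_finite_measure sg_measure by (rule sigma_finite_sg_measure)
  have [measurable]: "(\<lambda>y. dist x y) \<in> borel_measurable sg_measure"
    using measurable_compose[OF measurable_ident_sg_measure, of "dist x" borel] by simp
  have "(\<lambda>r. \<integral>\<^sup>+y. (if dist x y \<le> r then 1 else 0) \<partial>sg_measure) \<in> borel_measurable borel"
    by measurable
  then show ?thesis by (simp add: ball_volume_eq_nn_integral[OF measurable_ident_sg_measure, abs_def])
qed

lemma measurable_log_density_sg [measurable]:
  "log_density sg_measure a x \<in> borel_measurable borel"
  unfolding log_density_def[abs_def] by measurable

lemma log_density_sg_periodic: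
  "log_density sg_measure sg_dim 0 (ln 2 + t) = log_density sg_measure sg_dim 0 t"
proof -
  have "exp (- sg_dim * (ln 2 + t)) = exp (- sg_dim * t) / 2 powr sg_dim"
    by (simp add: powr_def exp_minus field_simps flip: exp_add)
  also have "\<dots> = exp (- sg_dim * t) / 3" by (simp add: sg_dim)
  finally have e: "ennreal (exp (- sg_dim * (ln 2 + t))) * 3 = ennreal (exp (- sg_dim * t))"
    by (simp flip: ennreal_numeral ennreal_mult)
  have "ball_volume sg_measure 0 (exp (ln 2 + t)) = 3 * ball_volume sg_measure 0 (exp t)"
    using ball_volume_sg_measure_double[of 0 "exp t"] by (simp add: exp_add)
  then show ?thesis unfolding log_density_def by (simp only: e mult.assoc[symmetric])
qed

lemma nn_integral_exp_decay:
  fixes \<alpha> a b :: real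
  assumes "0 < \<alpha>" "a \<le> b"
  shows "(\<integral>\<^sup>+t\<in>{a..b}. ennreal (exp (- \<alpha> * t)) \<partial>lborel) = ennreal ((exp (- \<alpha> * a) - exp (- \<alpha> * b)) / \<alpha>)"
proof -
  have "(\<integral>\<^sup>+t\<in>{a..b}. ennreal (exp (- \<alpha> * t)) \<partial>lborel)
      = ennreal ((- exp (- \<alpha> * b) / \<alpha>) - (- exp (- \<alpha> * a) / \<alpha>))"
    using assms by (intro nn_integral_FTC_Icc) (auto intro!: derivative_eq_intros)
  then show ?thesis by (simp add: diff_divide_distrib)
qed

definition sg_period_integral :: ennreal where
  "sg_period_integral = (\<integral>\<^sup>+t\<in>{0..ln 2}. log_density sg_measure sg_dim 0 t \<partial>lborel)"

text \<open>
  By Tonelli's theorem, the integral over a period is the integral over \<open>y\<close> of the integral of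
  \<open>exp (- sg_dim * t)\<close> over those \<open>t\<close> in \<open>{0..ln 2}\<close> with \<open>norm y \<le> exp t\<close>.  Multiplied by
  \<open>sg_dim\<close>, the inner integral is \<open>2 / 3\<close> in the unit ball and \<open>norm y powr - sg_dim - 1 / 3\<close> in the
  shell.  The shell has twice the measure of the unit ball, so the constants \<open>2 / 3\<close> and \<open>- 1 / 3\<close>
  cancel.
\<close>

lemma sg_period_integral_eq: "ennreal sg_dim * sg_period_integral = sg_shell_integral"
proof -
  let ?M = sg_measure
  let ?V = "ball_volume ?M 0"
  interpret sigma_finite_measure ?M by (rule sigma_finite_sg_measure)
  have [measurable]: "(\<lambda>y. norm y) \<in> borel_measurable ?M"
    using measurable_compose[OF measurable_ident_sg_measure, of norm borel] by simp
  have V: "?V r = (\<integral>\<^sup>+y. (if norm y \<le> r then 1 else 0) \<partial>?M)" for r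
    by (simp add: ball_volume_eq_nn_integral[OF measurable_ident_sg_measure])
  define in1 :: "real ^ 2 \<Rightarrow> ennreal" where "in1 y = (if norm y \<le> 1 then 1 else 0)" for y
  define sh :: "real ^ 2 \<Rightarrow> ennreal" where "sh y = (if 1 < norm y \<and> norm y \<le> 2 then 1 else 0)" for y
  have [measurable]: "in1 \<in> borel_measurable ?M" "sh \<in> borel_measurable ?M"
    unfolding in1_def[abs_def] sh_def[abs_def] by simp_all
  have [measurable]: "shell_kernel sg_dim 0 0 \<in> borel_measurable ?M"
    by (rule measurable_compose[OF measurable_ident_sg_measure measurable_shell_kernel])
  define g where "g t y = ennreal (exp (- sg_dim * t)) * (if norm y \<le> exp t \<and> t \<in> {0..ln 2} then 1 else 0)"
    for t :: real and y :: "real ^ 2"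
  have g_meas: "(\<lambda>(t, y). g t y) \<in> borel_measurable (lborel \<Otimes>\<^sub>M ?M)"
    unfolding g_def case_prod_beta' by measurable
  have "sg_period_integral = (\<integral>\<^sup>+t. \<integral>\<^sup>+y. g t y \<partial>?M \<partial>lborel)"
    unfolding sg_period_integral_def
  proof (intro nn_integral_cong)
    fix t :: real
    have "(\<integral>\<^sup>+y. g t y \<partial>?M) = (\<integral>\<^sup>+y. (ennreal (exp (- sg_dim * t)) * indicator {0..ln 2} t) * (if norm y \<le> exp t then 1 else 0) \<partial>?M)"
      by (intro nn_integral_cong) (simp add: g_def indicator_def)
    also have "\<dots> = (ennreal (exp (- sg_dim * t)) * indicator {0..ln 2} t) * ?V (exp t)"
      unfolding V by (rule nn_integral_cmult) measurable
    finally show "log_density ?M sg_dim 0 t * indicator {0..ln 2} t = (\<integral>\<^sup>+y. g t y \<partial>?M)"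
      by (simp add: log_density_def mult_ac)
  qed
  also have "\<dots> = (\<integral>\<^sup>+y. \<integral>\<^sup>+t. g t y \<partial>lborel \<partial>?M)"
    by (rule pair_sigma_finite.Fubini'[symmetric, OF _ g_meas])
      (simp add: pair_sigma_finite_def sigma_finite_sg_measure sigma_finite_lborel)
  finally have I: "sg_period_integral = (\<integral>\<^sup>+y. \<integral>\<^sup>+t. g t y \<partial>lborel \<partial>?M)" .
  have exp2: "exp (- sg_dim * ln 2) = 1 / 3"
    using sg_dim(2) by (simp add: powr_def exp_minus inverse_eq_divide)
  \<comment> \<open>The negative constant is moved to the left-hand side, where it is an addition in \<open>ennreal\<close>.\<close>
  have inner: "ennreal sg_dim * (\<integral>\<^sup>+t. g t y \<partial>lborel) + ennreal (1 / 3) * sh y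
      = ennreal (2 / 3) * in1 y + shell_kernel sg_dim 0 0 y" for y
  proof -
    consider "norm y \<le> 1" | "1 < norm y" "norm y \<le> 2" | "2 < norm y" by linarith
    then show ?thesis
    proof cases
      case 1
      have "(\<integral>\<^sup>+t. g t y \<partial>lborel) = (\<integral>\<^sup>+t\<in>{0..ln 2}. ennreal (exp (- sg_dim * t)) \<partial>lborel)"
      proof (intro nn_integral_cong)
        fix t :: real
        have "norm y \<le> exp t" if "0 \<le> t" using 1 one_le_exp_iff[of t] that by linarith
        then show "g t y = ennreal (exp (- sg_dim * t)) * indicator {0..ln 2} t"
          by (auto simp: g_def indicator_def)
      qed
      also have "\<dots> = ennreal ((1 - 1 / 3) / sg_dim)"
        using nn_integral_exp_decay[OF sg_dim(1), of 0 "ln 2"] by (simp only: exp2) simp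
      finally show ?thesis using 1 sg_dim(1)
        by (simp add: in1_def sh_def shell_kernel_def flip: ennreal_mult)
    next
      case 2
      have "(\<integral>\<^sup>+t. g t y \<partial>lborel) = (\<integral>\<^sup>+t\<in>{ln (norm y)..ln 2}. ennreal (exp (- sg_dim * t)) \<partial>lborel)"
      proof (intro nn_integral_cong)
        fix t :: real
        have "norm y \<le> exp t \<longleftrightarrow> ln (norm y) \<le> t" using 2 by (subst ln_le_cancel_iff[symmetric]) auto
        moreover have "0 < ln (norm y)" using 2 by (intro ln_gt_zero)
        ultimately show "g t y = ennreal (exp (- sg_dim * t)) * indicator {ln (norm y)..ln 2} t"
          by (auto simp: g_def indicator_def)
      qed
      also have "\<dots> = ennreal ((norm y powr - sg_dim - 1 / 3) / sg_dim)"
      proof -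
        have "y \<noteq> 0" using 2 by auto
        moreover from this have "ln (norm y) \<le> ln 2" using 2 by simp
        ultimately show ?thesis
          using nn_integral_exp_decay[OF sg_dim(1), of "ln (norm y)" "ln 2"]
          unfolding exp2 by (simp add: powr_def)
      qed
      finally have "(\<integral>\<^sup>+t. g t y \<partial>lborel) = ennreal ((norm y powr - sg_dim - 1 / 3) / sg_dim)" .
      moreover have "1 / 3 \<le> norm y powr - sg_dim"
      proof -
        have "1 / 3 = 2 powr - sg_dim" using sg_dim(2) by (simp add: powr_minus_divide)
        also have "\<dots> \<le> norm y powr - sg_dim" using 2 sg_dim(1) by (intro powr_mono2') auto
        finally show ?thesis .
      qed
      ultimately show ?thesis using 2 sg_dim(1)
        by (simp add: in1_def sh_def shell_kernel_def flip: ennreal_mult ennreal_plus)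
    next
      case 3
      have "g t y = 0" for t
      proof -
        have "exp t \<le> 2" if "t \<le> ln 2" using that by (metis exp_le_cancel_iff exp_ln zero_less_numeral)
        with 3 show ?thesis by (auto simp: g_def)
      qed
      with 3 show ?thesis by (simp add: in1_def sh_def shell_kernel_def)
    qed
  qed
  have gy: "(\<lambda>y. \<integral>\<^sup>+t. g t y \<partial>lborel) \<in> borel_measurable ?M"
    using g_meas by (intro sigma_finite_measure.borel_measurable_nn_integral[OF sigma_finite_lborel])
      (simp add: measurable_pair_swap_iff[of _ ?M] case_prod_beta')
  define A where "A = (\<integral>\<^sup>+y. sh y \<partial>?M)"
  have V1: "(\<integral>\<^sup>+y. in1 y \<partial>?M) = ?V 1" unfolding in1_def V by simp
  have "?V 2 = (\<integral>\<^sup>+y. in1 y + sh y \<partial>?M)"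
    unfolding V by (intro nn_integral_cong) (auto simp: in1_def sh_def)
  also have "\<dots> = ?V 1 + A" unfolding A_def V1[symmetric] by (rule nn_integral_add) measurable
  finally have "?V 1 + A = 3 * ?V 1" using ball_volume_sg_measure_double[of 0 1] by simp
  also have "(3::ennreal) = 1 + 2" by simp
  also have "(1 + 2) * ?V 1 = ?V 1 + 2 * ?V 1" by (simp only: distrib_right mult_1)
  finally have A: "A = 2 * ?V 1"
    using ball_volume_sg_measure_finite[of 0 1] by (auto simp: ennreal_add_left_cancel)
  have "ennreal sg_dim * sg_period_integral + ennreal (1 / 3) * A
      = (\<integral>\<^sup>+y. ennreal sg_dim * (\<integral>\<^sup>+t. g t y \<partial>lborel) + ennreal (1 / 3) * sh y \<partial>?M)"
    unfolding I A_def using gy by (subst nn_integral_add) (simp_all add: nn_integral_cmult)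
  also have "\<dots> = (\<integral>\<^sup>+y. ennreal (2 / 3) * in1 y + shell_kernel sg_dim 0 0 y \<partial>?M)"
    by (simp only: inner)
  also have "\<dots> = ennreal (2 / 3) * ?V 1 + sg_shell_integral"
    unfolding V1[symmetric] sg_shell_integral_def by (subst nn_integral_add) (simp_all add: nn_integral_cmult)
  also have "ennreal (2 / 3) * ?V 1 = ennreal (1 / 3) * A"
    unfolding A by (simp add: mult.assoc[symmetric] flip: ennreal_numeral ennreal_mult)
  finally have "ennreal (1 / 3) * A + ennreal sg_dim * sg_period_integral = ennreal (1 / 3) * A + sg_shell_integral"
    by (simp add: add.commute)
  moreover have "ennreal (1 / 3) * A \<noteq> top"
    using ball_volume_sg_measure_finite[of 0 1] unfolding A by (auto simp: ennreal_mult_eq_top_iff)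
  ultimately show ?thesis by (simp add: ennreal_add_left_cancel)
qed

lemma sg_period_integral_finite: "sg_period_integral < top"
  using sg_shell_integral_finite sg_dim(1)
  by (auto simp: sg_period_integral_eq[symmetric] ennreal_mult_less_top)

text \<open>
  Up to one period at the end, the integral up to \<open>T\<close> consists of \<open>T / L\<close> copies of the integral
  over a period.
\<close>

lemma periodic_average_tendsto:
  fixes h :: "real \<Rightarrow> ennreal" and L :: real
  assumes [measurable]: "h \<in> borel_measurable borel" and L: "0 < L" and per: "\<And>t. h (L + t) = h t"
    and fin: "(\<integral>\<^sup>+t\<in>{0..L}. h t \<partial>lborel) < top"
  shows "((\<lambda>T. (\<integral>\<^sup>+t\<in>{0..T}. h t \<partial>lborel) / ennreal T) \<longlongrightarrow> (\<integral>\<^sup>+t\<in>{0..L}. h t \<partial>lborel) / ennreal L) at_top"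
proof -
  define J where "J T = (\<integral>\<^sup>+t\<in>{0..T}. h t \<partial>lborel)" for T
  define j where "j = enn2real (J L)"
  have j: "J L = ennreal j" "0 \<le> j" using fin by (simp_all add: J_def j_def)
  have mono: "J S \<le> J T" if "S \<le> T" for S T
    unfolding J_def using that by (intro nn_integral_mono mult_left_mono) (auto simp: indicator_def)
  have add: "J (L + a) = J L + J a" if a: "0 \<le> a" for a
  proof -
    have "J (L + a) = (\<integral>\<^sup>+t. h t * indicator {0..L} t + h t * indicator {L<..L + a} t \<partial>lborel)"
      unfolding J_def using a L by (intro nn_integral_cong) (auto simp: indicator_def)
    also have "\<dots> = J L + (\<integral>\<^sup>+t. h t * indicator {L<..L + a} t \<partial>lborel)"
      unfolding J_def by (rule nn_integral_add) measurable
    also have "(\<integral>\<^sup>+t. h t * indicator {L<..L + a} t \<partial>lborel) = (\<integral>\<^sup>+t. h (L + 1 * t) * indicator {L<..L + a} (L + 1 * t) \<partial>lborel)"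
      by (subst nn_integral_real_affine[of _ 1 L]) simp_all
    also have "\<dots> = J a"
      unfolding J_def
    proof (rule nn_integral_cong_AE)
      have "AE t in lborel. t \<noteq> (0::real)" by (rule AE_lborel_singleton)
      then show "AE t in lborel. h (L + 1 * t) * indicator {L<..L + a} (L + 1 * t) = h t * indicator {0..a} t"
        by eventually_elim (auto simp: per indicator_def)
    qed
    finally show ?thesis .
  qed
  have mult: "J (real n * L) = ennreal (real n * j)" for n
  proof (induction n)
    case 0
    have "AE t in lborel. t \<noteq> (0::real)" by (rule AE_lborel_singleton)
    then have "AE t in lborel. h t * indicator {0..0} t = 0" by eventually_elim auto
    then have "J 0 = 0" unfolding J_def by (subst nn_integral_0_iff_AE) auto
    then show ?case by simp
  next
    case (Suc n)
    have "J (real (Suc n) * L) = J L + J (real n * L)"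
      using add[of "real n * L"] L by (simp add: algebra_simps)
    then show ?case using Suc j by (simp add: algebra_simps flip: ennreal_plus)
  qed
  have bounds: "ennreal ((T / L - 1) * j) \<le> J T \<and> J T \<le> ennreal ((T / L + 1) * j)" if T: "0 < T" for T
  proof -
    define n where "n = nat \<lfloor>T / L\<rfloor>"
    have "0 \<le> T / L" using T L by simp
    then have n: "real n \<le> T / L" "T / L < real n + 1" unfolding n_def by (simp_all add: floor_correct)
    then have nL: "real n * L \<le> T" "T \<le> real (Suc n) * L" using L by (simp_all add: field_simps)
    have "ennreal ((T / L - 1) * j) \<le> ennreal (real n * j)"
      using n j by (intro ennreal_leI mult_right_mono) auto
    also have "\<dots> \<le> J T" using mono[OF nL(1)] by (simp add: mult)
    finally have 1: "ennreal ((T / L - 1) * j) \<le> J T" .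
    have "J T \<le> ennreal (real (Suc n) * j)" using mono[OF nL(2)] by (simp only: mult)
    also have "\<dots> \<le> ennreal ((T / L + 1) * j)"
      using n j by (intro ennreal_leI mult_right_mono) auto
    finally show ?thesis using 1 by simp
  qed
  have div: "ennreal (x * j) / ennreal T = ennreal (x * j / T)" if "0 \<le> x" "0 < T" for x T
    using that j by (intro divide_ennreal) auto
  have ev: "eventually (\<lambda>T. T > max 0 L) at_top" by (rule eventually_gt_at_top)
  have lim: "((\<lambda>T. ennreal ((T / L + c) * j / T)) \<longlongrightarrow> ennreal (j / L)) at_top" for c
  proof (rule tendsto_ennrealI)
    have "((\<lambda>T. j / L + c * j * inverse T) \<longlongrightarrow> j / L + c * j * 0) at_top"
      by (intro tendsto_intros tendsto_inverse_0_at_top filterlim_ident)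
    moreover have "eventually (\<lambda>T. j / L + c * j * inverse T = (T / L + c) * j / T) at_top"
      using ev by eventually_elim (use L in \<open>auto simp: field_simps\<close>)
    ultimately show "((\<lambda>T. (T / L + c) * j / T) \<longlongrightarrow> j / L) at_top"
      by (simp add: filterlim_cong[OF refl refl])
  qed
  have "((\<lambda>T. J T / ennreal T) \<longlongrightarrow> ennreal (j / L)) at_top"
  proof (rule tendsto_sandwich[OF _ _ lim[of "-1"] lim[of 1]])
    show "eventually (\<lambda>T. ennreal ((T / L + - 1) * j / T) \<le> J T / ennreal T) at_top"
      using ev
    proof eventually_elim
      case (elim T)
      then have "0 < T" "0 \<le> T / L - 1" using L by (auto simp: field_simps)
      then show ?case using divide_right_mono_ennreal[OF conjunct1[OF bounds[of T]], of "ennreal T"] by (simp add: div)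
    qed
    show "eventually (\<lambda>T. J T / ennreal T \<le> ennreal ((T / L + 1) * j / T)) at_top"
      using ev
    proof eventually_elim
      case (elim T)
      then have "0 < T" "0 \<le> T / L + 1" using L by auto
      then show ?case using divide_right_mono_ennreal[OF conjunct2[OF bounds[of T]], of "ennreal T"] by (simp add: div)
    qed
  qed
  moreover have "J L / ennreal L = ennreal (j / L)" using j L by (simp add: divide_ennreal)
  ultimately show ?thesis by (simp add: J_def)
qed

lemma sg_origin_eq: "sg_origin = 0"
  by simp

lemma log_average_sg_tendsto:
  "(log_average sg_measure sg_dim 0 \<longlongrightarrow> sg_period_integral / ennreal (ln 2)) at_top"
  unfolding sg_period_integral_def log_average_def[abs_def]
  by (rule periodic_average_tendsto)
    (use sg_period_integral_finite in \<open>simp_all add: log_density_sg_periodic sg_period_integral_def\<close>)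

lemma sg_mean_density_eq: "sg_mean_density = sg_period_integral / ennreal (ln 2)"
  unfolding sg_mean_density_def mean_density_def sg_origin_eq
  by (rule tendsto_Lim[OF _ log_average_sg_tendsto]) simp

section \<open>The limit of the energies\<close>

theorem mainTheorem3:
  fixes p :: real
  assumes "1 \<le> p"
  shows "(log_average sg_measure sg_dim sg_origin \<longlongrightarrow> sg_mean_density) at_top \<and>
         sg_mean_density =
           (\<integral>\<^sup>+t\<in>{0..ln 2}. log_density sg_measure sg_dim sg_origin t \<partial>lborel) / ennreal (ln 2) \<and>
         sg_mean_density < \<infinity> \<and>
         (\<forall>u \<in> energy_domain sg_measure sg_dim p.
           ((\<lambda>s. energy sg_measure sg_dim p s u) \<longlongrightarrow>
              ennreal (2 * sg_dim / p) * sg_mean_density * ennreal (Lp_norm sg_measure p u powr p))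
             (at_right 0))"
proof (intro conjI ballI)
  have p: "0 < p" using assms by simp
  show "(log_average sg_measure sg_dim sg_origin \<longlongrightarrow> sg_mean_density) at_top"
    using log_average_sg_tendsto by (simp only: sg_mean_density_eq sg_origin_eq)
  show "sg_mean_density =
           (\<integral>\<^sup>+t\<in>{0..ln 2}. log_density sg_measure sg_dim sg_origin t \<partial>lborel) / ennreal (ln 2)"
    by (simp only: sg_mean_density_eq sg_origin_eq sg_period_integral_def)
  have div_ln2: "x / ennreal (ln 2) = ennreal (1 / ln 2) * x" for x
    by (simp add: divide_ennreal_def inverse_ennreal mult.commute inverse_eq_divide)
  show "sg_mean_density < \<infinity>"
    using sg_period_integral_finite by (simp add: sg_mean_density_eq div_ln2 ennreal_mult_less_top)
  fix u assume u: "u \<in> energy_domain sg_measure sg_dim p"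
  let ?\<Lambda> = "ennreal (1 / (p * ln 2)) * sg_shell_integral"
  obtain C where C: "eventually (\<lambda>s. \<forall>x. ennreal s * tail_integral sg_measure (sg_dim + s * p) 1 x \<le> ennreal C) (at_right 0)"
    using sg_tail_bound[OF p] by blast
  have lim: "((\<lambda>s. energy sg_measure sg_dim p s u) \<longlongrightarrow>
      2 * ?\<Lambda> * (\<integral>\<^sup>+x. ennreal (\<bar>u x\<bar> powr p) \<partial>sg_measure)) (at_right 0)"
  proof (rule energy_tendsto_of_tail[OF sigma_finite_sg_measure measurable_ident_sg_measure p _ _ _ u])
    show "?\<Lambda> < top" using sg_shell_integral_finite by (simp add: ennreal_mult_less_top)
    show "eventually (\<lambda>s. \<forall>x\<in>space sg_measure.
        ennreal s * tail_integral sg_measure (sg_dim + s * p) 1 x \<le> ennreal C) (at_right 0)"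
      using C by (auto elim: eventually_mono)
  qed (rule sg_tail_tendsto[OF p])
  \<comment> \<open>The two descriptions of the constant agree because of \<open>sg_period_integral_eq\<close>.\<close>
  have "ennreal (2 * sg_dim / p) * sg_mean_density
      = ennreal (2 * sg_dim / p * (1 / ln 2)) * sg_period_integral"
    using p sg_dim(1) by (simp add: sg_mean_density_eq div_ln2 mult.assoc[symmetric] flip: ennreal_mult)
  also have "2 * sg_dim / p * (1 / ln 2) = 2 * (1 / (p * ln 2)) * sg_dim" by simp
  also have "ennreal (2 * (1 / (p * ln 2)) * sg_dim) = 2 * ennreal (1 / (p * ln 2)) * ennreal sg_dim"
    using p sg_dim(1) by (subst ennreal_mult, simp, simp, subst ennreal_mult, simp_all)
  finally have const: "ennreal (2 * sg_dim / p) * sg_mean_density = 2 * ?\<Lambda>"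
    by (simp add: sg_period_integral_eq mult.assoc)
  have "integrable sg_measure (\<lambda>x. \<bar>u x\<bar> powr p)"
    using u by (auto simp: energy_domain_def Lp_space_def)
  then have "(\<integral>\<^sup>+x. ennreal (\<bar>u x\<bar> powr p) \<partial>sg_measure) = ennreal (\<integral>x. \<bar>u x\<bar> powr p \<partial>sg_measure)"
    by (rule nn_integral_eq_integral) simp
  also have "(\<integral>x. \<bar>u x\<bar> powr p \<partial>sg_measure) = Lp_norm sg_measure p u powr p"
    using p by (simp add: Lp_norm_def powr_powr)
  finally show "((\<lambda>s. energy sg_measure sg_dim p s u) \<longlongrightarrow>
      ennreal (2 * sg_dim / p) * sg_mean_density * ennreal (Lp_norm sg_measure p u powr p)) (at_right 0)"
    using lim by (simp only: const)
qed

end
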